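(* The equation $$u_{t}+\frac{1}{2}\,\frac{\sigma^{2}S^{2}u_{SS}}{\left(1-\rho\,\frac{g'(\rho u_{S})}{g(\rho u_{S})}\,S\,u_{SS}\right)^{2}}=0$$ for $u=u(S,t)$, where $g(\alpha)$ is a differentiable function on whose form no further constraint is put, admits a three-dimensional Lie algebra $L_3=\langle V_1,V_2,V_3\rangle$ spanned by the generators $$V_1=S\frac{\partial}{\partial S}+u\frac{\partial}{\partial u},\qquad V_2=\frac{\partial}{\partial u},\qquad V_3=\frac{\partial}{\partial t};$$ that is, $L_3$ is the symmetry algebra of this equation. The Lie algebra $L_3$ possesses the non-zero commutator relation $[V_1,V_2]=-V_2$. It has the two-dimensional subalgebra $L_2=\langle V_1,V_2\rangle$ spanned by $V_1,V_2$. The algebra $L_3$ is a decomposable Lie algebra and can be represented as a semi-direct sum $L_3=L_2\oplus\langle V_3\rangle$.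
   Context: The independent variables are $S,t$ and the dependent variable is $u$; $\sigma^2,\rho\in\mathbb{R}^+$ are parameters. Let $M$ be the space of points $(S,t,u)$ and $M^{(2)}$ the second jet bundle with coordinates $(S,t,u,u_S,u_t,u_{SS},u_{St},u_{tt})$. Write the PDE as $\Delta=0$, with $\Delta$ a smooth map from $M^{(2)}$ to $\mathbb{R}$. For $V=\xi(S,t,u)\partial_S+\tau(S,t,u)\partial_t+\varphi(S,t,u)\partial_u$ let $pr^{(2)}V$ be its second prolongation to $M^{(2)}$. The determining equations are $pr^{(2)}V(\Delta)=0$ modulo $\Delta=0$, a system of PDEs for $\xi,\tau,\varphi$. Its solutions give all infinitesimal generators admitted by the equation; the set of these generators forms a Lie algebra, called the Lie algebra admitted by the PDE, or the symmetry algebra of the PDE. The theorem concerns $g$ of general form. It is stated alongside it that the determining equations have a richer set of solutions when $g$ has a special form: a four-dimensional Lie algebra is admitted if and only if $g(\alpha)=c_2e^{c_1\alpha}$, $g(\alpha)=c_2\alpha^{c_1}$ or $g(\alpha)=c_2(\rho+k\alpha)^{-1/c_1}$, with constants $c_1,c_2,k$. *)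

theory Defs
  imports "HOL-Analysis.Analysis" "HOL-Library.Function_Algebras"
begin

section \<open>Lie algebras\<close>

instantiation "fun" :: (type, real_vector) real_vector
begin

definition scaleR_fun :: "real \<Rightarrow> ('a \<Rightarrow> 'b) \<Rightarrow> 'a \<Rightarrow> 'b"
  where "scaleR_fun c f = (\<lambda>x. c *\<^sub>R f x)"

instance
  by standard (auto simp: scaleR_fun_def fun_eq_iff scaleR_add_right scaleR_add_left)

end

definition lie_algebra :: "('v::real_vector \<Rightarrow> 'v \<Rightarrow> 'v) \<Rightarrow> 'v set \<Rightarrow> bool"
  where "lie_algebra br L \<longleftrightarrow>
    subspace L \<and>
    (\<forall>x\<in>L. \<forall>y\<in>L. br x y \<in> L) \<and>
    (\<forall>x\<in>L. \<forall>y\<in>L. \<forall>z\<in>L. \<forall>a b. br (a *\<^sub>R x + b *\<^sub>R y) z = a *\<^sub>R br x z + b *\<^sub>R br y z) \<and>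
    (\<forall>x\<in>L. \<forall>y\<in>L. \<forall>z\<in>L. \<forall>a b. br z (a *\<^sub>R x + b *\<^sub>R y) = a *\<^sub>R br z x + b *\<^sub>R br z y) \<and>
    (\<forall>x\<in>L. br x x = 0) \<and>
    (\<forall>x\<in>L. \<forall>y\<in>L. \<forall>z\<in>L. br x (br y z) + br y (br z x) + br z (br x y) = 0)"

definition lie_subalgebra :: "('v::real_vector \<Rightarrow> 'v \<Rightarrow> 'v) \<Rightarrow> 'v set \<Rightarrow> 'v set \<Rightarrow> bool"
  where "lie_subalgebra br L A \<longleftrightarrow> A \<subseteq> L \<and> subspace A \<and> (\<forall>x\<in>A. \<forall>y\<in>A. br x y \<in> A)"

definition lie_ideal :: "('v::real_vector \<Rightarrow> 'v \<Rightarrow> 'v) \<Rightarrow> 'v set \<Rightarrow> 'v set \<Rightarrow> bool"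
  where "lie_ideal br L A \<longleftrightarrow> A \<subseteq> L \<and> subspace A \<and> (\<forall>x\<in>L. \<forall>y\<in>A. br x y \<in> A)"

definition internal_direct_sum :: "'v::real_vector set \<Rightarrow> 'v set \<Rightarrow> 'v set \<Rightarrow> bool"
  where "internal_direct_sum L A B \<longleftrightarrow> L = {x + y |x y. x \<in> A \<and> y \<in> B} \<and> A \<inter> B = {0}"

definition decomposable :: "('v::real_vector \<Rightarrow> 'v \<Rightarrow> 'v) \<Rightarrow> 'v set \<Rightarrow> bool"
  where "decomposable br L \<longleftrightarrow>
    (\<exists>A B. lie_ideal br L A \<and> lie_ideal br L B \<and> A \<noteq> {0} \<and> B \<noteq> {0} \<and> internal_direct_sum L A B)"

text \<open>The first summand \<open>N\<close> is the ideal, the second summand \<open>K\<close> the complementary subalgebra.\<close>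

definition semidirect_sum ::
    "('v::real_vector \<Rightarrow> 'v \<Rightarrow> 'v) \<Rightarrow> 'v set \<Rightarrow> 'v set \<Rightarrow> 'v set \<Rightarrow> bool"
  where "semidirect_sum br L N K \<longleftrightarrow>
    lie_ideal br L N \<and> lie_subalgebra br L K \<and> internal_direct_sum L N K"


section \<open>Vector fields on the space of independent and dependent variables\<close>

text \<open>Points are triples \<open>(S, t, u)\<close>. A vector field
  \<open>\<xi> \<partial>\<^sub>S + \<tau> \<partial>\<^sub>t + \<phi> \<partial>\<^sub>u\<close> on an open set \<open>M\<close> is the map \<open>(\<xi>, \<tau>, \<phi>)\<close>, extended by \<open>0\<close>
  outside \<open>M\<close>, so that equality of functions is equality of vector fields on \<open>M\<close>.\<close>

type_synonym point = "real \<times> real \<times> real"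
type_synonym vfield = "point \<Rightarrow> point"

definition xi_coeff :: "vfield \<Rightarrow> point \<Rightarrow> real"
  where "xi_coeff V x = fst (V x)"

definition tau_coeff :: "vfield \<Rightarrow> point \<Rightarrow> real"
  where "tau_coeff V x = fst (snd (V x))"

definition phi_coeff :: "vfield \<Rightarrow> point \<Rightarrow> real"
  where "phi_coeff V x = snd (snd (V x))"

definition vfield_on :: "point set \<Rightarrow> vfield \<Rightarrow> vfield"
  where "vfield_on M V = (\<lambda>x. if x \<in> M then V x else 0)"

text \<open>Differentiability class \<open>C\<^sup>k\<close> on an open set.\<close>

fun Ck_on :: "nat \<Rightarrow> 'a::euclidean_space set \<Rightarrow> ('a \<Rightarrow> 'b::real_normed_vector) \<Rightarrow> bool" where
  "Ck_on 0 M f \<longleftrightarrow> continuous_on M f"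
| "Ck_on (Suc k) M f \<longleftrightarrow>
     (\<forall>x\<in>M. f differentiable (at x)) \<and>
     (\<forall>i\<in>Basis. Ck_on k M (\<lambda>x. frechet_derivative f (at x) i))"

definition smooth_vfields :: "point set \<Rightarrow> vfield set"
  where "smooth_vfields M = {V. (\<forall>k. Ck_on k M V) \<and> (\<forall>x. x \<notin> M \<longrightarrow> V x = 0)}"

definition lie_bracket :: "point set \<Rightarrow> vfield \<Rightarrow> vfield \<Rightarrow> vfield"
  where "lie_bracket M V W = vfield_on M
    (\<lambda>x. frechet_derivative W (at x) (V x) - frechet_derivative V (at x) (W x))"


section \<open>Second prolongation\<close>

text \<open>Coordinates of the second jet space: \<open>(S, t, u, u\<^sub>S, u\<^sub>t, u\<^sub>S\<^sub>S, u\<^sub>S\<^sub>t, u\<^sub>t\<^sub>t)\<close>.\<close>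

type_synonym jet2 = "real \<times> real \<times> real \<times> real \<times> real \<times> real \<times> real \<times> real"

fun base_point :: "jet2 \<Rightarrow> point" where
  "base_point (S, t, u, uS, ut, uSS, uSt, utt) = (S, t, u)"

fun jet_uS :: "jet2 \<Rightarrow> real" where
  "jet_uS (S, t, u, uS, ut, uSS, uSt, utt) = uS"

fun jet_ut :: "jet2 \<Rightarrow> real" where
  "jet_ut (S, t, u, uS, ut, uSS, uSt, utt) = ut"

fun jet_uSS :: "jet2 \<Rightarrow> real" where
  "jet_uSS (S, t, u, uS, ut, uSS, uSt, utt) = uSS"

fun jet_uSt :: "jet2 \<Rightarrow> real" where
  "jet_uSt (S, t, u, uS, ut, uSS, uSt, utt) = uSt"

fun jet_utt :: "jet2 \<Rightarrow> real" where
  "jet_utt (S, t, u, uS, ut, uSS, uSt, utt) = utt"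

text \<open>The total derivatives
  \<open>D\<^sub>S = \<partial>\<^sub>S + u\<^sub>S \<partial>\<^sub>u + u\<^sub>S\<^sub>S \<partial>\<^bsub>u\<^sub>S\<^esub> + u\<^sub>S\<^sub>t \<partial>\<^bsub>u\<^sub>t\<^esub>\<close> and
  \<open>D\<^sub>t = \<partial>\<^sub>t + u\<^sub>t \<partial>\<^sub>u + u\<^sub>S\<^sub>t \<partial>\<^bsub>u\<^sub>S\<^esub> + u\<^sub>t\<^sub>t \<partial>\<^bsub>u\<^sub>t\<^esub>\<close>.
  They are only applied to functions that do not depend on the second-order coordinates, so no
  third-order terms occur.\<close>

definition total_S :: "(jet2 \<Rightarrow> real) \<Rightarrow> jet2 \<Rightarrow> real"
  where "total_S f j = frechet_derivative f (at j) (1, 0, jet_uS j, jet_uSS j, jet_uSt j, 0, 0, 0)"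

definition total_t :: "(jet2 \<Rightarrow> real) \<Rightarrow> jet2 \<Rightarrow> real"
  where "total_t f j = frechet_derivative f (at j) (0, 1, jet_ut j, jet_uSt j, jet_utt j, 0, 0, 0)"

definition prolong_S :: "vfield \<Rightarrow> jet2 \<Rightarrow> real"
  where "prolong_S V j =
    total_S (phi_coeff V \<circ> base_point) j
    - jet_uS j * total_S (xi_coeff V \<circ> base_point) j
    - jet_ut j * total_S (tau_coeff V \<circ> base_point) j"

definition prolong_t :: "vfield \<Rightarrow> jet2 \<Rightarrow> real"
  where "prolong_t V j =
    total_t (phi_coeff V \<circ> base_point) j
    - jet_uS j * total_t (xi_coeff V \<circ> base_point) j
    - jet_ut j * total_t (tau_coeff V \<circ> base_point) j"

definition prolong_SS :: "vfield \<Rightarrow> jet2 \<Rightarrow> real"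
  where "prolong_SS V j =
    total_S (prolong_S V) j
    - jet_uSS j * total_S (xi_coeff V \<circ> base_point) j
    - jet_uSt j * total_S (tau_coeff V \<circ> base_point) j"

definition prolong_St :: "vfield \<Rightarrow> jet2 \<Rightarrow> real"
  where "prolong_St V j =
    total_t (prolong_S V) j
    - jet_uSS j * total_t (xi_coeff V \<circ> base_point) j
    - jet_uSt j * total_t (tau_coeff V \<circ> base_point) j"

definition prolong_tt :: "vfield \<Rightarrow> jet2 \<Rightarrow> real"
  where "prolong_tt V j =
    total_t (prolong_t V) j
    - jet_uSt j * total_t (xi_coeff V \<circ> base_point) j
    - jet_utt j * total_t (tau_coeff V \<circ> base_point) j"

definition prolongation2 :: "vfield \<Rightarrow> jet2 \<Rightarrow> jet2"
  where "prolongation2 V j =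
    (xi_coeff V (base_point j), tau_coeff V (base_point j), phi_coeff V (base_point j),
     prolong_S V j, prolong_t V j, prolong_SS V j, prolong_St V j, prolong_tt V j)"

text \<open>The prolonged vector field acting as a derivation on functions on the jet space.\<close>

definition prolongation2_apply :: "vfield \<Rightarrow> (jet2 \<Rightarrow> real) \<Rightarrow> jet2 \<Rightarrow> real"
  where "prolongation2_apply V \<Delta> j = frechet_derivative \<Delta> (at j) (prolongation2 V j)"

text \<open>Symmetry algebra of the equation \<open>\<Delta> = 0\<close>, where \<open>\<Delta>\<close> is considered on the open subset \<open>U\<close>
  of the second jet space over \<open>M\<close>.\<close>

definition symmetry_algebra :: "point set \<Rightarrow> jet2 set \<Rightarrow> (jet2 \<Rightarrow> real) \<Rightarrow> vfield set"
  where "symmetry_algebra M U \<Delta> =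
    {V \<in> smooth_vfields M. \<forall>j\<in>U. \<Delta> j = 0 \<longrightarrow> prolongation2_apply V \<Delta> j = 0}"


section \<open>The equation\<close>

fun feedback_denom :: "real \<Rightarrow> (real \<Rightarrow> real) \<Rightarrow> jet2 \<Rightarrow> real" where
  "feedback_denom \<rho> g (S, t, u, uS, ut, uSS, uSt, utt) =
     1 - \<rho> * (deriv g (\<rho> * uS) / g (\<rho> * uS)) * S * uSS"

fun pde_lhs :: "real \<Rightarrow> real \<Rightarrow> (real \<Rightarrow> real) \<Rightarrow> jet2 \<Rightarrow> real" where
  "pde_lhs \<sigma> \<rho> g (S, t, u, uS, ut, uSS, uSt, utt) =
     ut + 1/2 * ((\<sigma>\<^sup>2 * S\<^sup>2 * uSS) /
       (feedback_denom \<rho> g (S, t, u, uS, ut, uSS, uSt, utt))\<^sup>2)"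

text \<open>The part of the jet space on which the left-hand side is defined: \<open>g\<close> is a function on the
  interval \<open>J\<close>, and the denominator must not vanish.\<close>

definition pde_domain :: "point set \<Rightarrow> real set \<Rightarrow> real \<Rightarrow> (real \<Rightarrow> real) \<Rightarrow> jet2 set"
  where "pde_domain M J \<rho> g =
    {j. base_point j \<in> M \<and> \<rho> * jet_uS j \<in> J \<and> feedback_denom \<rho> g j \<noteq> 0}"

definition pde_symmetry_algebra ::
    "point set \<Rightarrow> real set \<Rightarrow> real \<Rightarrow> real \<Rightarrow> (real \<Rightarrow> real) \<Rightarrow> vfield set"
  where "pde_symmetry_algebra M J \<sigma> \<rho> g =
    symmetry_algebra M (pde_domain M J \<rho> g) (pde_lhs \<sigma> \<rho> g)"

text \<open>The special forms \<open>c\<^sub>2 e\<^bsup>c\<^sub>1\<alpha>\<^esup>\<close>, \<open>c\<^sub>2 \<alpha>\<^bsup>c\<^sub>1\<^esup>\<close> and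
  \<open>c\<^sub>2 (\<rho> + k\<alpha>)\<^bsup>-1/c\<^sub>1\<^esup>\<close> of \<open>g\<close>. The absolute values account for intervals on which the base of
  the power is negative; there the sign of a power with, say, an odd integer exponent is absorbed
  in \<open>c\<^sub>2\<close>.\<close>

definition special_form :: "real set \<Rightarrow> real \<Rightarrow> (real \<Rightarrow> real) \<Rightarrow> bool"
  where "special_form J \<rho> g \<longleftrightarrow>
    (\<exists>c1 c2. \<forall>\<alpha>\<in>J. g \<alpha> = c2 * exp (c1 * \<alpha>)) \<or>
    (\<exists>c1 c2. \<forall>\<alpha>\<in>J. g \<alpha> = c2 * \<bar>\<alpha>\<bar> powr c1) \<or>
    (\<exists>c1 c2 k. c1 \<noteq> 0 \<and> (\<forall>\<alpha>\<in>J. g \<alpha> = c2 * \<bar>\<rho> + k * \<alpha>\<bar> powr (- 1 / c1)))"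


section \<open>The generators\<close>

definition V1 :: "point set \<Rightarrow> vfield"
  where "V1 M = vfield_on M (\<lambda>(S, t, u). (S, 0, u))"

definition V2 :: "point set \<Rightarrow> vfield"
  where "V2 M = vfield_on M (\<lambda>(S, t, u). (0, 0, 1))"

definition V3 :: "point set \<Rightarrow> vfield"
  where "V3 M = vfield_on M (\<lambda>(S, t, u). (0, 1, 0))"

definition L3 :: "point set \<Rightarrow> vfield set"
  where "L3 M = span {V1 M, V2 M, V3 M}"

definition L2 :: "point set \<Rightarrow> vfield set"
  where "L2 M = span {V1 M, V2 M}"

end

theory Submission
  imports Defs
begin

text \<open>Write \<open>H(p) = \<rho> g'(\<rho>p)/g(\<rho>p)\<close> for \<open>p = u\<^sub>S\<close> and fix a point with \<open>S \<noteq> 0\<close>. The coefficient of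
  \<open>u\<^sub>S\<^sub>t\<close> in the symmetry condition gives \<open>\<tau> = \<tau>(t)\<close>. After eliminating \<open>u\<^sub>t\<close> and multiplying by the
  cube of the denominator the condition is a cubic polynomial in \<open>u\<^sub>S\<^sub>S\<close>. Its coefficients, compared
  as functions of \<open>p\<close>, yield linear equations for \<open>\<xi>, \<tau>, \<phi>\<close>, which force \<open>\<tau>\<^sub>t = \<xi>\<^sub>S\<^sub>S = 0\<close>, and the
  classifying equation \<open>\<beta> H + H' (\<alpha> + \<beta> p) = 0\<close> with \<open>\<alpha> = \<phi>\<^sub>S\<close> and \<open>\<beta> = \<phi>\<^sub>u - \<xi>\<^sub>S\<close>. A non-trivial
  \<open>(\<alpha>, \<beta>)\<close> makes \<open>H (\<alpha> + \<beta> p)\<close> constant, which is exactly the case of the special forms of \<open>g\<close>.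
  Points with \<open>S = 0\<close> are reached by continuity, and connectedness of \<open>M\<close> makes the remaining
  parameters constants.\<close>

section \<open>Smooth functions\<close>

text \<open>Every derivative involved is taken at a point of the open set \<open>M\<close>, so
  values outside \<open>M\<close> do not matter. This is what allows explicit formulas to be used
  for vector fields that are cut off to 0 outside \<open>M\<close>.\<close>

lemma Ck_on_cong:
  assumes "open M" "\<And>x. x \<in> M \<Longrightarrow> f x = g x"
  shows "Ck_on k M f \<longleftrightarrow> Ck_on k M g"
  using assms(2)
proof (induction k arbitrary: f g)
  case 0
  then show ?case by (simp cong: continuous_on_cong)
next
  case (Suc k)
  have diff: "f differentiable (at x) \<longleftrightarrow> g differentiable (at x)" if "x \<in> M" for x
    using has_derivative_transform_within_open[OF _ \<open>open M\<close> that] Suc.prems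
    unfolding differentiable_def by metis
  have fd: "frechet_derivative f (at x) = frechet_derivative g (at x)" if "x \<in> M" for x
  proof -
    have "(f has_derivative D) (at x) \<longleftrightarrow> (g has_derivative D) (at x)" for D
      using has_derivative_transform_within_open[OF _ \<open>open M\<close> that] Suc.prems by metis
    then show ?thesis unfolding frechet_derivative_def by simp
  qed
  have "Ck_on k M (\<lambda>x. frechet_derivative f (at x) i) \<longleftrightarrow>
        Ck_on k M (\<lambda>x. frechet_derivative g (at x) i)" for i
    by (rule Suc.IH) (simp add: fd)
  then show ?case using diff by simp
qed

lemma Ck_on_const: "Ck_on k M (\<lambda>x. c)"
  by (induction k arbitrary: c) simp_all

lemma Ck_on_affine:
  assumes "bounded_linear L"
  shows "Ck_on k M (\<lambda>x. L x + c)"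
proof (cases k)
  case 0
  then show ?thesis
    using linear_continuous_on[OF assms, of M] by (simp add: continuous_on_add)
next
  case (Suc l)
  have *: "((\<lambda>x. L x + c) has_derivative L) (at x)" for x
    using has_derivative_add[OF bounded_linear_imp_has_derivative[OF assms] has_derivative_const]
    by simp
  then have "frechet_derivative (\<lambda>x. L x + c) (at x) = L" for x
    using frechet_derivative_at by metis
  then show ?thesis
    using * Suc by (auto simp: differentiable_def Ck_on_const)
qed

text \<open>A bounded linear map commutes with differentiation. Applied to the coordinate
  projections, this makes the coefficients of a smooth vector field smooth.\<close>

lemma Ck_on_bounded_linear:
  assumes "open M" "bounded_linear L" "Ck_on k M f"
  shows "Ck_on k M (\<lambda>x. L (f x))"
  using assms(3)
proof (induction k arbitrary: f)
  case 0
  then show ?case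
    using bounded_linear.continuous_on[OF assms(2)] by simp
next
  case (Suc k)
  have D: "((\<lambda>x. L (f x)) has_derivative (\<lambda>h. L (frechet_derivative f (at x) h))) (at x)"
    if "x \<in> M" for x
    using Suc.prems that
    by (intro bounded_linear.has_derivative[OF assms(2)]) (simp add: frechet_derivative_works[symmetric])
  then have eq: "frechet_derivative (\<lambda>x. L (f x)) (at x) = (\<lambda>h. L (frechet_derivative f (at x) h))"
    if "x \<in> M" for x
    using that frechet_derivative_at by metis
  have "Ck_on k M (\<lambda>x. frechet_derivative (\<lambda>x. L (f x)) (at x) i)" if "i \<in> Basis" for i
    using Suc.IH[of "\<lambda>x. frechet_derivative f (at x) i"] Suc.prems that eq
    by (subst Ck_on_cong[OF \<open>open M\<close>]) auto
  then show ?case using D by (auto simp: differentiable_def)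
qed

section \<open>Smooth real-valued functions and their directional derivatives\<close>

definition smooth_fun :: "'a::euclidean_space set \<Rightarrow> ('a \<Rightarrow> real) \<Rightarrow> bool"
  where "smooth_fun M f \<longleftrightarrow> (\<forall>k. Ck_on k M f)"

definition partial :: "'a::real_normed_vector \<Rightarrow> ('a \<Rightarrow> real) \<Rightarrow> 'a \<Rightarrow> real"
  where "partial v f x = frechet_derivative f (at x) v"

lemma smooth_fun_partial:
  assumes "smooth_fun M f" "i \<in> Basis"
  shows "smooth_fun M (partial i f)"
  unfolding smooth_fun_def partial_def
proof
  fix k
  have "Ck_on (Suc k) M f" using assms(1) by (simp add: smooth_fun_def)
  then show "Ck_on k M (\<lambda>x. frechet_derivative f (at x) i)"
    using assms(2) by simp
qed

lemma smooth_fun_differentiable: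
  assumes "smooth_fun M f" "x \<in> M"
  shows "f differentiable (at x)"
proof -
  have "Ck_on (Suc 0) M f" using assms(1) unfolding smooth_fun_def by blast
  then show ?thesis using assms(2) by simp
qed

lemma smooth_fun_continuous: "smooth_fun M f \<Longrightarrow> continuous_on M f"
  unfolding smooth_fun_def by (metis Ck_on.simps(1))

lemma partial_cong:
  assumes "open M" "x \<in> M" "\<And>y. y \<in> M \<Longrightarrow> f y = g y"
  shows "partial v f x = partial v g x"
proof -
  have "(f has_derivative D) (at x) \<longleftrightarrow> (g has_derivative D) (at x)" for D
    using has_derivative_transform_within_open[OF _ assms(1,2)] assms(3) by metis
  then show ?thesis unfolding partial_def frechet_derivative_def by simp
qed

lemma partial_zero:
  assumes "open M" "x \<in> M" "\<And>y. y \<in> M \<Longrightarrow> f y = 0"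
  shows "partial v f x = 0"
  using partial_cong[OF assms(1,2), of f "\<lambda>_. 0"] assms(3) by (simp add: partial_def)

lemma partial_linear_combination:
  assumes "f differentiable (at x)" "h differentiable (at x)"
  shows "partial v (\<lambda>x. a * f x + b * h x) x = a * partial v f x + b * partial v h x"
proof -
  have "((\<lambda>x. a * f x + b * h x) has_derivative
      (\<lambda>v. a * frechet_derivative f (at x) v + b * frechet_derivative h (at x) v)) (at x)"
    using assms unfolding frechet_derivative_works
    by (intro has_derivative_add has_derivative_mult_right)
  then show ?thesis
    unfolding partial_def using frechet_derivative_at by metis
qed

section \<open>Symmetry of second partial derivatives\<close>

lemma has_real_derivative_along_line:
  assumes "f differentiable (at (x + s *\<^sub>R a))"
  shows "((\<lambda>s. f (x + s *\<^sub>R a)) has_real_derivative partial a f (x + s *\<^sub>R a)) (at s)"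
proof -
  have *: "((\<lambda>s. x + s *\<^sub>R a) has_derivative (\<lambda>h. h *\<^sub>R a)) (at s)"
    by (auto intro!: derivative_eq_intros)
  have f: "(f has_derivative frechet_derivative f (at (x + s *\<^sub>R a))) (at (x + s *\<^sub>R a))"
    using assms frechet_derivative_works by blast
  have "((\<lambda>s. f (x + s *\<^sub>R a)) has_derivative
      (\<lambda>h. frechet_derivative f (at (x + s *\<^sub>R a)) (h *\<^sub>R a))) (at s)"
    using has_derivative_compose[OF * f] .
  moreover have "frechet_derivative f (at (x + s *\<^sub>R a)) (h *\<^sub>R a)
      = partial a f (x + s *\<^sub>R a) * h" for h
    using linear_scale[OF linear_frechet_derivative[OF assms]] by (simp add: partial_def)
  ultimately show ?thesis by (simp add: has_field_derivative_def)
qed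

text \<open>The mean value theorem is used twice: first in direction \<open>a\<close> for the
  difference of \<open>f\<close> along two parallel edges, then in direction \<open>b\<close> for
  \<open>partial a f\<close>.\<close>

lemma second_difference_mvt:
  assumes h: "h > 0"
    and sq: "\<And>s t. s \<in> {0..h} \<Longrightarrow> t \<in> {0..h} \<Longrightarrow> x + s *\<^sub>R a + t *\<^sub>R b \<in> M"
    and f: "\<And>y. y \<in> M \<Longrightarrow> f differentiable (at y)"
    and fa: "\<And>y. y \<in> M \<Longrightarrow> partial a f differentiable (at y)"
  obtains s t where "s \<in> {0..h}" "t \<in> {0..h}"
    "f (x + h *\<^sub>R a + h *\<^sub>R b) - f (x + h *\<^sub>R a) - f (x + h *\<^sub>R b) + f x
      = h\<^sup>2 * partial b (partial a f) (x + s *\<^sub>R a + t *\<^sub>R b)"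
proof -
  define G where "G s = f (x + h *\<^sub>R b + s *\<^sub>R a) - f (x + s *\<^sub>R a)" for s
  have G: "(G has_real_derivative
      partial a f (x + h *\<^sub>R b + s *\<^sub>R a) - partial a f (x + s *\<^sub>R a)) (at s)"
    if "s \<in> {0..h}" for s
    unfolding G_def
    using sq[of s h] sq[of s 0] that h
    by (intro DERIV_diff has_real_derivative_along_line f) (auto simp: algebra_simps)
  obtain s where s: "0 < s" "s < h"
    "G h - G 0 = h * (partial a f (x + h *\<^sub>R b + s *\<^sub>R a) - partial a f (x + s *\<^sub>R a))"
    using MVT2[OF h, of G "\<lambda>s. partial a f (x + h *\<^sub>R b + s *\<^sub>R a) - partial a f (x + s *\<^sub>R a)"] G
    by auto
  have K: "((\<lambda>t. partial a f ((x + s *\<^sub>R a) + t *\<^sub>R b)) has_real_derivative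
      partial b (partial a f) ((x + s *\<^sub>R a) + t *\<^sub>R b)) (at t)" if "t \<in> {0..h}" for t
    using s that sq[of s t] by (intro has_real_derivative_along_line fa) auto
  obtain t where t: "0 < t" "t < h"
    "partial a f ((x + s *\<^sub>R a) + h *\<^sub>R b) - partial a f ((x + s *\<^sub>R a) + 0 *\<^sub>R b)
      = h * partial b (partial a f) ((x + s *\<^sub>R a) + t *\<^sub>R b)"
    using MVT2[OF h, of "\<lambda>t. partial a f ((x + s *\<^sub>R a) + t *\<^sub>R b)"
        "\<lambda>t. partial b (partial a f) ((x + s *\<^sub>R a) + t *\<^sub>R b)"] K
    by auto
  have "G h - G 0 = h\<^sup>2 * partial b (partial a f) (x + s *\<^sub>R a + t *\<^sub>R b)"
    using s(3) t(3) by (simp add: algebra_simps power2_eq_square)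
  then show thesis
    using s t by (intro that[of s t]) (auto simp: G_def algebra_simps)
qed

text \<open>The second difference over a small square is symmetric in \<open>a\<close> and
  \<open>b\<close>. Hence the two mixed derivatives take a common value at two points near
  \<open>x\<close>, and their continuity excludes different values at \<open>x\<close>.\<close>

lemma partial_commute:
  fixes f :: "'a::euclidean_space \<Rightarrow> real"
  assumes M: "open M" "x \<in> M" and f: "smooth_fun M f" and ab: "a \<in> Basis" "b \<in> Basis"
  shows "partial b (partial a f) x = partial a (partial b f) x"
proof (rule ccontr)
  define P where "P = partial b (partial a f)"
  define Q where "Q = partial a (partial b f)"
  assume "partial b (partial a f) x \<noteq> partial a (partial b f) x"
  then have e: "dist (P x) (Q x) / 2 > 0" (is "?e > 0") by (simp add: P_def Q_def)
  note sm = f smooth_fun_partial[OF f ab(1)] smooth_fun_partial[OF f ab(2)]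
  have cont: "isCont P x" "isCont Q x"
    using smooth_fun_continuous[OF smooth_fun_partial[OF sm(2) ab(2)]]
      smooth_fun_continuous[OF smooth_fun_partial[OF sm(3) ab(1)]] M
    by (auto simp: P_def Q_def continuous_on_eq_continuous_at)
  obtain d1 where d1: "d1 > 0" "\<And>y. dist y x < d1 \<Longrightarrow> dist (P y) (P x) < ?e"
    using cont(1) e unfolding continuous_at_eps_delta by blast
  obtain d2 where d2: "d2 > 0" "\<And>y. dist y x < d2 \<Longrightarrow> dist (Q y) (Q x) < ?e"
    using cont(2) e unfolding continuous_at_eps_delta by blast
  obtain d3 where d3: "d3 > 0" "ball x d3 \<subseteq> M"
    using M openE by blast
  define d where "d = min d1 (min d2 d3)"
  have d: "d > 0" "d \<le> d1" "d \<le> d2" "d \<le> d3" using d1 d2 d3 by (auto simp: d_def)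
  \<comment> \<open>Points of the square with side \<open>h\<close> are at distance at most
    \<open>2 * h < d\<close> from \<open>x\<close>.\<close>
  define h where "h = d / 3"
  have h: "h > 0" using d by (simp add: h_def)
  have near: "dist (x + s *\<^sub>R v + t *\<^sub>R w) x < d"
    if "s \<in> {0..h}" "t \<in> {0..h}" "v \<in> Basis" "w \<in> Basis" for s t and v w :: 'a
  proof -
    have "norm (s *\<^sub>R v + t *\<^sub>R w) \<le> s + t"
      using norm_triangle_ineq[of "s *\<^sub>R v" "t *\<^sub>R w"] that by simp
    also have "\<dots> < d" using that d by (auto simp: h_def)
    finally show ?thesis by (simp add: dist_norm add.assoc)
  qed
  have inM: "x + s *\<^sub>R v + t *\<^sub>R w \<in> M"
    if "s \<in> {0..h}" "t \<in> {0..h}" "v \<in> Basis" "w \<in> Basis" for s t and v w :: 'a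
    using near[OF that] d d3 by (auto simp: dist_commute subset_eq)
  have diff: "g differentiable (at y)" if "smooth_fun M g" "y \<in> M" for g y
    using smooth_fun_differentiable that by blast
  obtain s t where st: "s \<in> {0..h}" "t \<in> {0..h}"
    "f (x + h *\<^sub>R a + h *\<^sub>R b) - f (x + h *\<^sub>R a) - f (x + h *\<^sub>R b) + f x
      = h\<^sup>2 * P (x + s *\<^sub>R a + t *\<^sub>R b)"
    unfolding P_def
    by (rule second_difference_mvt[OF h, of x a b M f]) (use inM ab sm diff in auto)
  obtain s' t' where st': "s' \<in> {0..h}" "t' \<in> {0..h}"
    "f (x + h *\<^sub>R b + h *\<^sub>R a) - f (x + h *\<^sub>R b) - f (x + h *\<^sub>R a) + f x
      = h\<^sup>2 * Q (x + s' *\<^sub>R b + t' *\<^sub>R a)"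
    unfolding Q_def
    by (rule second_difference_mvt[OF h, of x b a M f]) (use inM ab sm diff in auto)
  have "h\<^sup>2 * P (x + s *\<^sub>R a + t *\<^sub>R b) = h\<^sup>2 * Q (x + s' *\<^sub>R b + t' *\<^sub>R a)"
    using st(3) st'(3) by (simp add: algebra_simps)
  then have eq: "P (x + s *\<^sub>R a + t *\<^sub>R b) = Q (x + s' *\<^sub>R b + t' *\<^sub>R a)"
    using h by simp
  have "dist (P (x + s *\<^sub>R a + t *\<^sub>R b)) (P x) < ?e"
    using near[OF st(1,2) ab] d by (intro d1) simp
  moreover have "dist (Q (x + s' *\<^sub>R b + t' *\<^sub>R a)) (Q x) < ?e"
    using near[OF st'(1,2) ab(2,1)] d by (intro d2) simp
  ultimately show False
    unfolding eq dist_real_def by (simp add: abs_real_def split: if_splits)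
qed

section \<open>Prolongation in coordinates\<close>

abbreviation dS :: "(point \<Rightarrow> real) \<Rightarrow> point \<Rightarrow> real" where "dS \<equiv> partial (1, 0, 0)"
abbreviation dt :: "(point \<Rightarrow> real) \<Rightarrow> point \<Rightarrow> real" where "dt \<equiv> partial (0, 1, 0)"
abbreviation du :: "(point \<Rightarrow> real) \<Rightarrow> point \<Rightarrow> real" where "du \<equiv> partial (0, 0, 1)"

lemma point_Basis: "(Basis :: point set) = {(1, 0, 0), (0, 1, 0), (0, 0, 1)}"
  by (auto simp: Basis_prod_def zero_prod_def)

lemma frechet_derivative_coordinates:
  fixes f :: "point \<Rightarrow> real"
  assumes "f differentiable (at x)"
  shows "frechet_derivative f (at x) (a, b, c) = a * dS f x + b * dt f x + c * du f x"
proof -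
  interpret linear "frechet_derivative f (at x)"
    by (rule linear_frechet_derivative[OF assms])
  have "frechet_derivative f (at x) (a *\<^sub>R (1, 0, 0) + b *\<^sub>R (0, 1, 0) + c *\<^sub>R (0, 0, 1))
      = a * dS f x + b * dt f x + c * du f x"
    unfolding add scale by (simp add: partial_def)
  then show ?thesis by simp
qed

text \<open>The product rule for the factor S, which occurs when determining equations are
  differentiated.\<close>

lemma partial_fst_mult:
  fixes f :: "point \<Rightarrow> real"
  assumes "f differentiable (at x)"
  shows "(\<lambda>x. fst x * f x) differentiable (at x)"
    "partial v (\<lambda>x. fst x * f x) x = fst x * partial v f x + fst v * f x"
proof -
  have D: "((\<lambda>x. fst x * f x) has_derivative
      (\<lambda>v. fst x * frechet_derivative f (at x) v + fst v * f x)) (at x)"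
    using assms unfolding frechet_derivative_works
    by (intro has_derivative_mult has_derivative_fst has_derivative_ident)
  then show "(\<lambda>x. fst x * f x) differentiable (at x)"
    unfolding differentiable_def by blast
  show "partial v (\<lambda>x. fst x * f x) x = fst x * partial v f x + fst v * f x"
    unfolding partial_def frechet_derivative_at[OF D, symmetric] ..
qed

lemma constant_if_partials_zero:
  assumes M: "open M" "connected M"
    and f: "\<And>x. x \<in> M \<Longrightarrow> f differentiable (at x)"
    and f0: "\<And>x. x \<in> M \<Longrightarrow> dS f x = 0" "\<And>x. x \<in> M \<Longrightarrow> dt f x = 0" "\<And>x. x \<in> M \<Longrightarrow> du f x = 0"
  obtains k where "\<And>x. x \<in> M \<Longrightarrow> f x = k"
proof (cases "M = {}")
  case False
  then obtain x where x: "x \<in> M" by blast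
  have "(f has_derivative (\<lambda>v. 0)) (at y)" if y: "y \<in> M" for y
  proof -
    have "frechet_derivative f (at y) v = 0" for v
      using frechet_derivative_coordinates[OF f[OF y], of "fst v" "fst (snd v)" "snd (snd v)"]
        f0[OF y] by simp
    then have "frechet_derivative f (at y) = (\<lambda>v. 0)" by (simp add: fun_eq_iff)
    then show ?thesis using f[OF y] frechet_derivative_works by metis
  qed
  then have "f y = f x" if "y \<in> M" for y
    using has_derivative_zero_unique_connected[OF M, of f y x] that x by blast
  then show thesis using that by blast
qed (use that in blast)

text \<open>Compositions of projections replace pattern matching, so that the rules for bounded
  linear maps apply.\<close>

lemma jet_coordinates:
  "base_point = (\<lambda>j. (fst j, fst (snd j), fst (snd (snd j))))"
  "jet_uS = (\<lambda>j. fst (snd (snd (snd j))))"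
  "jet_ut = (\<lambda>j. fst (snd (snd (snd (snd j)))))"
  by (auto simp: fun_eq_iff)

lemma bounded_linear_jet:
  "bounded_linear base_point" "bounded_linear jet_uS" "bounded_linear jet_ut"
  unfolding jet_coordinates
  by (intro bounded_linear_Pair bounded_linear_fst bounded_linear_snd
    bounded_linear_compose[OF bounded_linear_fst] bounded_linear_compose[OF bounded_linear_snd])+

lemmas has_derivative_jet = bounded_linear_jet(2,3)[THEN bounded_linear_imp_has_derivative]

lemma has_derivative_base:
  assumes "f differentiable (at (base_point j))"
  shows "((\<lambda>j. f (base_point j)) has_derivative
    (\<lambda>v. frechet_derivative f (at (base_point j)) (base_point v))) (at j)"
  using has_derivative_compose[OF bounded_linear_imp_has_derivative[OF bounded_linear_jet(1)]]
    assms frechet_derivative_works by blast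

text \<open>By the chain rule only the base components \<open>(1, 0, jet_uS j)\<close> of the
  direction matter.\<close>

lemma total_S_base:
  assumes "f differentiable (at (base_point j))"
  shows "total_S (f \<circ> base_point) j = dS f (base_point j) + jet_uS j * du f (base_point j)"
  unfolding total_S_def comp_def frechet_derivative_at[OF has_derivative_base[OF assms], symmetric]
  by (simp add: frechet_derivative_coordinates[OF assms])

lemma total_t_base:
  assumes "f differentiable (at (base_point j))"
  shows "total_t (f \<circ> base_point) j = dt f (base_point j) + jet_ut j * du f (base_point j)"
  unfolding total_t_def comp_def frechet_derivative_at[OF has_derivative_base[OF assms], symmetric]
  by (simp add: frechet_derivative_coordinates[OF assms])

section \<open>Prolongation coefficients of a smooth vector field\<close>

locale smooth_vfield =
  fixes M :: "point set" and V :: vfield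
  assumes open_M: "open M" and smooth: "V \<in> smooth_vfields M"
begin

abbreviation "\<xi> \<equiv> xi_coeff V"
abbreviation "\<tau> \<equiv> tau_coeff V"
abbreviation "\<phi> \<equiv> phi_coeff V"

lemma smooth_coeffs: "smooth_fun M \<xi>" "smooth_fun M \<tau>" "smooth_fun M \<phi>"
proof -
  have V: "Ck_on k M V" for k using smooth by (simp add: smooth_vfields_def)
  have lin: "bounded_linear (\<lambda>x::point. fst x)" "bounded_linear (\<lambda>x::point. fst (snd x))"
    "bounded_linear (\<lambda>x::point. snd (snd x))"
    by (intro bounded_linear_fst bounded_linear_snd bounded_linear_compose[OF bounded_linear_fst]
      bounded_linear_compose[OF bounded_linear_snd])+
  show "smooth_fun M \<xi>" "smooth_fun M \<tau>" "smooth_fun M \<phi>"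
    using Ck_on_bounded_linear[OF open_M _ V] lin
    unfolding smooth_fun_def xi_coeff_def[abs_def] tau_coeff_def[abs_def] phi_coeff_def[abs_def]
    by blast+
qed

lemma smooth_partial:
  assumes "smooth_fun M f"
  shows "smooth_fun M (dS f)" "smooth_fun M (dt f)" "smooth_fun M (du f)"
  using smooth_fun_partial[OF assms] by (auto simp: point_Basis)

lemma diff:
  assumes "smooth_fun M f" "x \<in> M"
  shows "f differentiable (at x)"
  using smooth_fun_differentiable assms .

lemma prolong_S_coordinates:
  assumes "base_point j \<in> M"
  shows "prolong_S V j = dS \<phi> (base_point j) + jet_uS j * du \<phi> (base_point j)
    - jet_uS j * (dS \<xi> (base_point j) + jet_uS j * du \<xi> (base_point j))
    - jet_ut j * (dS \<tau> (base_point j) + jet_uS j * du \<tau> (base_point j))"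
  using assms unfolding prolong_S_def by (simp add: total_S_base diff smooth_coeffs)

lemma prolong_t_coordinates:
  assumes "base_point j \<in> M"
  shows "prolong_t V j = dt \<phi> (base_point j) + jet_ut j * du \<phi> (base_point j)
    - jet_uS j * (dt \<xi> (base_point j) + jet_ut j * du \<xi> (base_point j))
    - jet_ut j * (dt \<tau> (base_point j) + jet_ut j * du \<tau> (base_point j))"
  using assms unfolding prolong_t_def by (simp add: total_t_base diff smooth_coeffs)

text \<open>This is the product rule applied to the formula for \<open>prolong_S\<close>. The two
  orders of mixed derivatives are kept apart here and are identified only where the formula is
  used.\<close>

lemma prolong_SS_coordinates:
  assumes x: "x = (S, t, u)" "x \<in> M" and j: "j = (S, t, u, p, q, r, s, w)"
  shows "prolong_SS V j =
      dS (dS \<phi>) x + p * du (dS \<phi>) x + r * du \<phi> x + p * (dS (du \<phi>) x + p * du (du \<phi>) x)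
      - 2 * r * (dS \<xi> x + p * du \<xi> x)
      - p * (dS (dS \<xi>) x + p * du (dS \<xi>) x + r * du \<xi> x + p * (dS (du \<xi>) x + p * du (du \<xi>) x))
      - 2 * s * (dS \<tau> x + p * du \<tau> x)
      - q * (dS (dS \<tau>) x + p * du (dS \<tau>) x + r * du \<tau> x + p * (dS (du \<tau>) x + p * du (du \<tau>) x))"
proof -
  define G where "G = (\<lambda>j. dS \<phi> (base_point j) + jet_uS j * du \<phi> (base_point j)
    - jet_uS j * (dS \<xi> (base_point j) + jet_uS j * du \<xi> (base_point j))
    - jet_ut j * (dS \<tau> (base_point j) + jet_uS j * du \<tau> (base_point j)))"
  have bj: "base_point j = x" using x j by simp
  have dif: "f differentiable (at (base_point j))" if "smooth_fun M f" for f
    using diff that x bj by simp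
  note D = has_derivative_base[OF dif]
  \<comment> \<open>\<open>total_S\<close> differentiates at \<open>j\<close> in this
    direction.\<close>
  let ?e = "(1, 0, p, r, s, 0, 0, 0) :: jet2"
  define E where "E f = dS f x + p * du f x" for f
  have E: "frechet_derivative f (at (base_point j)) (base_point ?e) = E f" if "smooth_fun M f" for f
    using frechet_derivative_coordinates[OF diff[OF that x(2)]] bj by (simp add: E_def)
  note sm = smooth_coeffs smooth_coeffs[THEN smooth_partial(1)] smooth_coeffs[THEN smooth_partial(3)]
  have op: "open (base_point -` M)"
    using open_M bounded_linear_jet(1)
    by (intro continuous_open_vimage) (auto intro: linear_continuous_at)
  obtain G' where G': "(G has_derivative G') (at j)" and
    "G' ?e = E (dS \<phi>) + (p * E (du \<phi>) + r * du \<phi> x)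
      - (p * (E (dS \<xi>) + (p * E (du \<xi>) + r * du \<xi> x)) + r * (dS \<xi> x + p * du \<xi> x))
      - (q * (E (dS \<tau>) + (p * E (du \<tau>) + r * du \<tau> x)) + s * (dS \<tau> x + p * du \<tau> x))"
  proof
    show "(G has_derivative (\<lambda>v.
      frechet_derivative (dS \<phi>) (at (base_point j)) (base_point v)
      + (jet_uS j * frechet_derivative (du \<phi>) (at (base_point j)) (base_point v) + jet_uS v * du \<phi> (base_point j))
      - (jet_uS j * (frechet_derivative (dS \<xi>) (at (base_point j)) (base_point v)
            + (jet_uS j * frechet_derivative (du \<xi>) (at (base_point j)) (base_point v) + jet_uS v * du \<xi> (base_point j)))
         + jet_uS v * (dS \<xi> (base_point j) + jet_uS j * du \<xi> (base_point j)))
      - (jet_ut j * (frechet_derivative (dS \<tau>) (at (base_point j)) (base_point v)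
            + (jet_uS j * frechet_derivative (du \<tau>) (at (base_point j)) (base_point v) + jet_uS v * du \<tau> (base_point j)))
         + jet_ut v * (dS \<tau> (base_point j) + jet_uS j * du \<tau> (base_point j))))) (at j)"
      unfolding G_def
      by (intro has_derivative_add has_derivative_diff has_derivative_mult D has_derivative_jet sm)
  qed (use E sm bj j in simp)
  \<comment> \<open>\<open>prolong_S V\<close> is known to agree with \<open>G\<close> over
    \<open>M\<close> only; the preimage of \<open>M\<close> is open, which suffices for the
    derivative at \<open>j\<close>.\<close>
  moreover have "(prolong_S V has_derivative G') (at j)"
    using x bj prolong_S_coordinates
    by (intro has_derivative_transform_within_open[OF G' op]) (auto simp: G_def)
  then have "frechet_derivative (prolong_S V) (at j) = G'"
    using frechet_derivative_at by metis
  ultimately have "total_S (prolong_S V) j = E (dS \<phi>) + (p * E (du \<phi>) + r * du \<phi> x)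
      - (p * (E (dS \<xi>) + (p * E (du \<xi>) + r * du \<xi> x)) + r * (dS \<xi> x + p * du \<xi> x))
      - (q * (E (dS \<tau>) + (p * E (du \<tau>) + r * du \<tau> x)) + s * (dS \<tau> x + p * du \<tau> x))"
    unfolding total_S_def j by simp
  moreover have "total_S (f \<circ> base_point) j = dS f x + p * du f x" if "smooth_fun M f" for f
    using total_S_base[OF dif[OF that]] bj j by simp
  ultimately show ?thesis
    unfolding prolong_SS_def E_def using sm j by (simp add: algebra_simps)
qed

end

text \<open>The quotient rule produces the denominator \<open>D ^ 4\<close>, and one factor
  \<open>D\<close> cancels. The remaining cube is what multiplication by \<open>D ^ 3\<close> clears
  later.\<close>

lemma pde_lhs_derivative:
  fixes H :: "real \<Rightarrow> real"
  assumes H: "\<And>p. H p = \<rho> * (deriv g (\<rho> * p) / g (\<rho> * p))"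
    and H': "(H has_real_derivative H') (at p)"
    and D: "D = 1 - H p * S * r" "D \<noteq> 0"
  shows "frechet_derivative (pde_lhs \<sigma> \<rho> g) (at (S, t, u, p, q, r, s, w))
      (a, b, c, d1, d2, d11, d12, d22) =
    d2 + \<sigma>\<^sup>2 / 2 * ((2 * S * a * r + S\<^sup>2 * d11) * D
      + 2 * S\<^sup>2 * r * (H' * d1 * S * r + H p * a * r + H p * S * d11)) / D ^ 3"
proof -
  let ?S = "\<lambda>j::jet2. fst j" and ?p = "\<lambda>j::jet2. fst (snd (snd (snd j)))"
    and ?q = "\<lambda>j::jet2. fst (snd (snd (snd (snd j))))"
    and ?r = "\<lambda>j::jet2. fst (snd (snd (snd (snd (snd j)))))"
  let ?j = "(S, t, u, p, q, r, s, w)"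
  have pde: "pde_lhs \<sigma> \<rho> g = (\<lambda>j. ?q j + 1/2 * (\<sigma>\<^sup>2 * (?S j)\<^sup>2 * ?r j / (1 - H (?p j) * ?S j * ?r j)\<^sup>2))"
    by (auto simp: fun_eq_iff H)
  have HD: "((\<lambda>j. H (?p j)) has_derivative (\<lambda>v. H' * ?p v)) (at ?j)"
  proof -
    have "(?p has_derivative ?p) (at ?j)"
      by (intro derivative_intros has_derivative_ident)
    from has_derivative_compose[OF this, of H "\<lambda>x. H' * x"] H' show ?thesis
      by (simp add: has_field_derivative_def)
  qed
  have "(pde_lhs \<sigma> \<rho> g has_derivative (\<lambda>v. ?q v + 1/2 * (
      (\<sigma>\<^sup>2 * (2 * S * ?S v * r + S\<^sup>2 * ?r v) * D\<^sup>2
       + \<sigma>\<^sup>2 * S\<^sup>2 * r * (2 * D * (H' * ?p v * S * r + H p * ?S v * r + H p * S * ?r v))) / (D\<^sup>2 * D\<^sup>2)))) (at ?j)"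
    unfolding pde using D
    by (auto intro!: derivative_eq_intros HD) (auto simp: fun_eq_iff field_simps power2_eq_square)
  from frechet_derivative_at[OF this, symmetric] show ?thesis
    using D(2) by (simp add: field_simps power2_eq_square power3_eq_cube)
qed

section \<open>The exceptional functions\<close>

lemma constant_if_derivative_zero:
  fixes f :: "real \<Rightarrow> real"
  assumes "open J" "connected J" "\<And>y. y \<in> J \<Longrightarrow> (f has_real_derivative 0) (at y)"
  obtains c where "\<And>y. y \<in> J \<Longrightarrow> f y = c"
proof (cases "J = {}")
  case False
  then obtain x where "x \<in> J" by blast
  have "f y = f x" if "y \<in> J" for y
    using assms that \<open>x \<in> J\<close>
    by (intro has_derivative_zero_unique_connected[of J f]) (auto simp: has_field_derivative_def lambda_zero)
  then show ?thesis using that by blast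
qed (use that in blast)

text \<open>The hypothesis \<open>lin\<close> is a separable linear equation for \<open>g\<close>.
  Its solutions are exponentials if \<beta> = 0 and multiples of a power of
  \<open>\<bar>\<rho> * \<alpha> + \<beta> * y\<bar>\<close> otherwise. The hypothesis
  \<open>zero\<close> covers zeros of the linear factor, where \<open>lin\<close> says nothing about
  \<open>g'\<close> when C = 0.\<close>

lemma special_form_if_first_integral:
  fixes g :: "real \<Rightarrow> real"
  assumes J: "open J" "connected J"
    and g': "\<And>y. y \<in> J \<Longrightarrow> (g has_real_derivative g' y) (at y)"
    and lin: "\<And>y. y \<in> J \<Longrightarrow> g' y * (\<rho> * \<alpha> + \<beta> * y) = C * g y"
    and zero: "\<And>y. y \<in> J \<Longrightarrow> \<rho> * \<alpha> + \<beta> * y = 0 \<Longrightarrow> g' y = 0"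
    and nz: "\<alpha> \<noteq> 0 \<or> \<beta> \<noteq> 0" and \<rho>: "\<rho> > 0"
    and gnz: "\<And>y. y \<in> J \<Longrightarrow> g y \<noteq> 0"
  shows "special_form J \<rho> g"
proof -
  have exponential: ?thesis if k: "\<And>y. y \<in> J \<Longrightarrow> g' y = k * g y" for k
  proof -
    have "((\<lambda>y. g y * exp (- k * y)) has_real_derivative 0) (at y)" if "y \<in> J" for y
      using k[OF that] by (auto intro!: derivative_eq_intros g'[OF that])
    from constant_if_derivative_zero[OF J this]
    obtain c where c: "\<And>y. y \<in> J \<Longrightarrow> g y * exp (- k * y) = c"
      by blast
    have "g y = c * exp (k * y)" if "y \<in> J" for y
      unfolding c[OF that, symmetric] by (simp add: exp_minus field_simps)
    then show ?thesis unfolding special_form_def by blast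
  qed
  consider "\<beta> = 0" | "\<beta> \<noteq> 0" "C = 0" | "\<beta> \<noteq> 0" "C \<noteq> 0" by blast
  then show ?thesis
  proof cases
    case 1
    then have "\<rho> * \<alpha> \<noteq> 0" using nz \<rho> by simp
    then show ?thesis
      using lin 1 by (intro exponential[of "C / (\<rho> * \<alpha>)"]) (simp add: field_simps)
  next
    case 2
    have "g' y = 0 * g y" if "y \<in> J" for y
      using lin[OF that] zero[OF that] 2 by auto
    then show ?thesis by (rule exponential)
  next
    case 3
    define l where "l y = \<rho> * \<alpha> + \<beta> * y" for y
    define e where "e = C / \<beta>"
    \<comment> \<open>At a zero of \<open>l\<close> the equation would read
      \<open>0 = C * g y\<close> with both factors non-zero.\<close>
    have l: "l y \<noteq> 0" if "y \<in> J" for y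
      using lin[OF that] 3 gnz[OF that] by (auto simp: l_def)
    \<comment> \<open>The integrating factor is \<open>\<bar>l y\<bar> powr (- e)\<close>; writing
      it with the square avoids a distinction by the sign of \<open>l y\<close>.\<close>
    have "((\<lambda>y. g y * exp (- (e / 2) * ln ((l y)\<^sup>2))) has_real_derivative 0) (at y)"
      if "y \<in> J" for y
    proof -
      have l': "(l has_real_derivative \<beta>) (at y)"
        unfolding l_def[abs_def] by (auto intro!: derivative_eq_intros)
      have "g' y - g y * (e / 2) * (2 * l y * \<beta> / (l y)\<^sup>2) = 0"
        using lin[OF that] l[OF that] 3 unfolding e_def l_def[symmetric]
        by (simp add: field_simps power2_eq_square)
      moreover have "((\<lambda>y. g y * exp (- (e / 2) * ln ((l y)\<^sup>2))) has_real_derivative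
          exp (- (e / 2) * ln ((l y)\<^sup>2)) * (g' y - g y * (e / 2) * (2 * l y * \<beta> / (l y)\<^sup>2))) (at y)"
        using l[OF that]
        by (auto intro!: derivative_eq_intros g'[OF that] l' simp: algebra_simps)
      ultimately show ?thesis by simp
    qed
    from constant_if_derivative_zero[OF J this]
    obtain c where c: "\<And>y. y \<in> J \<Longrightarrow> g y * exp (- (e / 2) * ln ((l y)\<^sup>2)) = c"
      by blast
    have g: "g y = c * \<bar>l y\<bar> powr e" if "y \<in> J" for y
    proof -
      have "ln ((l y)\<^sup>2) = 2 * ln \<bar>l y\<bar>"
        using ln_realpow[of "\<bar>l y\<bar>" 2] l[OF that] by simp
      then show ?thesis
        unfolding c[OF that, symmetric] using l[OF that] by (simp add: powr_def exp_minus)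
    qed
    show ?thesis
    proof (cases "\<alpha> = 0")
      case True
      have "g y = (c * \<bar>\<beta>\<bar> powr e) * \<bar>y\<bar> powr e" if "y \<in> J" for y
        using g[OF that] True by (simp add: l_def abs_mult powr_mult)
      then show ?thesis unfolding special_form_def by blast
    next
      case False
      \<comment> \<open>Extracting the factor \<alpha> from \<open>l y\<close> gives
        \<open>k = \<beta> / \<alpha>\<close>, and \<open>c1 = - \<beta> / C\<close> is chosen so
        that \<open>- 1 / c1 = e\<close>.\<close>
      have "g y = (c * \<bar>\<alpha>\<bar> powr e) * \<bar>\<rho> + \<beta> / \<alpha> * y\<bar> powr (- 1 / (- \<beta> / C))" if "y \<in> J" for y
      proof -
        have "l y = \<alpha> * (\<rho> + \<beta> / \<alpha> * y)" using False by (simp add: l_def field_simps)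
        then show ?thesis using g[OF that] 3 by (simp add: abs_mult powr_mult e_def)
      qed
      moreover have "- \<beta> / C \<noteq> 0" using 3 by simp
      ultimately show ?thesis unfolding special_form_def by blast
    qed
  qed
qed

text \<open>A non-zero polynomial has finitely many roots. The lemma serves for comparing
  coefficients both in the variable u_SS and in the variable p.\<close>

lemma cubic_coeffs_zero:
  fixes c0 :: real
  assumes "infinite A" "\<And>x. x \<in> A \<Longrightarrow> c0 + c1 * x + c2 * x\<^sup>2 + c3 * x ^ 3 = 0"
  shows "c0 = 0" "c1 = 0" "c2 = 0" "c3 = 0"
proof -
  have "A \<subseteq> {x. poly [:c0, c1, c2, c3:] x = 0}"
    using assms(2) by (auto simp: algebra_simps power2_eq_square power3_eq_cube)
  then have "[:c0, c1, c2, c3:] = 0"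
    using assms(1) poly_roots_finite finite_subset by blast
  then show "c0 = 0" "c1 = 0" "c2 = 0" "c3 = 0" by simp_all
qed

lemma linear_coeffs_zero:
  fixes c0 :: real
  assumes "infinite A" "\<And>x. x \<in> A \<Longrightarrow> c0 + c1 * x = 0"
  shows "c0 = 0" "c1 = 0"
  using cubic_coeffs_zero[OF assms(1), of c0 c1 0 0] assms(2) by auto

section \<open>The generated Lie algebra\<close>

text \<open>The field is \<open>a *\<^sub>R V1 M + b *\<^sub>R V3 M + c *\<^sub>R V2 M\<close>.
  Naming it by its parameters turns computations in \<open>L3 M\<close> into arithmetic with
  triples.\<close>

definition affine_field :: "point set \<Rightarrow> real \<Rightarrow> real \<Rightarrow> real \<Rightarrow> vfield"
  where "affine_field M a b c = vfield_on M (\<lambda>(S, t, u). (a * S, b, a * u + c))"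

lemma affine_field_apply:
  "x \<in> M \<Longrightarrow> affine_field M a b c x = (a * fst x, b, a * snd (snd x) + c)"
  "x \<notin> M \<Longrightarrow> affine_field M a b c x = 0"
  by (auto simp: affine_field_def vfield_on_def split: prod.splits)

lemma V_affine_field:
  "V1 M = affine_field M 1 0 0" "V2 M = affine_field M 0 0 1" "V3 M = affine_field M 0 1 0"
  by (auto simp: V1_def V2_def V3_def affine_field_def vfield_on_def fun_eq_iff)

lemma affine_field_arith:
  "affine_field M a b c + affine_field M a' b' c' = affine_field M (a + a') (b + b') (c + c')"
  "affine_field M a b c - affine_field M a' b' c' = affine_field M (a - a') (b - b') (c - c')"
  "- affine_field M a b c = affine_field M (- a) (- b) (- c)"
  "k *\<^sub>R affine_field M a b c = affine_field M (k * a) (k * b) (k * c)"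
  "affine_field M 0 0 0 = 0"
  by (auto simp: affine_field_def vfield_on_def fun_eq_iff scaleR_fun_def zero_prod_def algebra_simps)

lemma span_V:
  "span {V3 M} = range (\<lambda>b. affine_field M 0 b 0)"
  "L2 M = {affine_field M a 0 c |a c. True}"
  "L3 M = {affine_field M a b c |a b c. True}"
proof -
  show "span {V3 M} = range (\<lambda>b. affine_field M 0 b 0)"
    by (simp add: span_singleton V_affine_field affine_field_arith)
  show V12: "L2 M = {affine_field M a 0 c |a c. True}"
    unfolding L2_def span_insert[of "V1 M"] span_singleton
    by (auto simp: V_affine_field diff_eq_eq affine_field_arith image_iff)
  have "L3 M = span (insert (V3 M) {V1 M, V2 M})"
    by (simp add: L3_def insert_commute)
  also have "\<dots> = {x. \<exists>k. x - k *\<^sub>R V3 M \<in> L2 M}"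
    by (simp add: span_insert[of "V3 M"] L2_def)
  also have "\<dots> = {affine_field M a b c |a b c. True}"
    unfolding V12 by (auto simp: V_affine_field diff_eq_eq affine_field_arith)
  finally show "L3 M = {affine_field M a b c |a b c. True}" .
qed

text \<open>The plane S = 0 has empty interior.\<close>

lemma open_nonzero_fst:
  fixes U :: "point set"
  assumes "open U" "x \<in> U"
  obtains y where "y \<in> U" "fst y \<noteq> 0"
proof (cases "fst x = 0")
  case True
  obtain e where e: "e > 0" "ball x e \<subseteq> U" using assms openE by blast
  have "x + (e / 2, 0, 0) \<in> ball x e"
    using e(1) by (simp add: dist_norm norm_Pair)
  then show ?thesis using that[of "x + (e / 2, 0, 0)"] e True by auto
qed (use that assms in blast)

text \<open>At a point with S different from 0 the first component determines \<open>a\<close>; the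
  other two components then determine \<open>b\<close> and \<open>c\<close>.\<close>

lemma affine_field_eq_iff:
  assumes "open M" "M \<noteq> {}"
  shows "affine_field M a b c = affine_field M a' b' c' \<longleftrightarrow> a = a' \<and> b = b' \<and> c = c'"
proof
  assume eq: "affine_field M a b c = affine_field M a' b' c'"
  obtain x where x: "x \<in> M" "fst x \<noteq> 0" using assms open_nonzero_fst by blast
  from fun_cong[OF eq, of x] show "a = a' \<and> b = b' \<and> c = c'"
    using x by (auto simp: affine_field_apply)
qed simp

section \<open>Derivatives and brackets of affine fields\<close>

lemma bounded_linear_coordinates:
  "bounded_linear (\<lambda>x::point. a * fst x)"
  "bounded_linear (\<lambda>x::point. a * snd (snd x))"
  "bounded_linear (\<lambda>x::point. (a * fst x, 0::real, a * snd (snd x)))"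
  by (intro bounded_linear_Pair bounded_linear_zero bounded_linear_fst
    bounded_linear_compose[OF bounded_linear_mult_right]
    bounded_linear_compose[OF bounded_linear_snd] bounded_linear_snd)+

lemma frechet_derivative_affine:
  assumes "open M" "x \<in> M" "bounded_linear L" "\<And>y. y \<in> M \<Longrightarrow> f y = L y + c"
  shows "frechet_derivative f (at x) = L"
proof -
  have "((\<lambda>y. L y + c) has_derivative L) (at x)"
    using has_derivative_add[OF bounded_linear_imp_has_derivative[OF assms(3)] has_derivative_const]
    by simp
  from has_derivative_transform_within_open[OF this assms(1,2), of f] show ?thesis
    using assms(4) by (metis frechet_derivative_at)
qed

text \<open>The sum of a linear part and a constant is the shape that
  \<open>frechet_derivative_affine\<close> expects.\<close>

lemma affine_field_decompose:
  "x \<in> M \<Longrightarrow> affine_field M a b c x = (a * fst x, 0, a * snd (snd x)) + (0, b, c)"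
  by (simp add: affine_field_apply)

text \<open>The linear parts are multiples of one diagonal map and commute, so only the action on
  the constant parts remains. That map annihilates the t-direction, so \<open>b\<close> and
  \<open>b'\<close> drop out.\<close>

lemma lie_bracket_affine_field:
  assumes "open M"
  shows "lie_bracket M (affine_field M a b c) (affine_field M a' b' c')
    = affine_field M 0 0 (a' * c - a * c')"
proof
  fix x
  show "lie_bracket M (affine_field M a b c) (affine_field M a' b' c') x
    = affine_field M 0 0 (a' * c - a * c') x"
  proof (cases "x \<in> M")
    case True
    note D = frechet_derivative_affine[OF assms True bounded_linear_coordinates(3) affine_field_decompose]
    show ?thesis
      using True by (simp add: lie_bracket_def vfield_on_def D affine_field_apply algebra_simps)
  qed (simp add: lie_bracket_def vfield_on_def affine_field_apply)
qed

lemma internal_direct_sum_commute: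
  assumes "internal_direct_sum L A B"
  shows "internal_direct_sum L B A"
proof -
  have "{x + y |x y. x \<in> A \<and> y \<in> B} = {x + y |x y. x \<in> B \<and> y \<in> A}"
    by (metis add.commute)
  then show ?thesis using assms by (auto simp: internal_direct_sum_def)
qed

text \<open>All brackets are multiples of \<open>V2 M\<close>, and \<open>V3 M\<close> is central.
  Hence both \<open>L2 M\<close> and the span of \<open>V3 M\<close> are ideals.\<close>

lemma lie_structure:
  assumes M: "open M" "M \<noteq> {}"
  shows "lie_algebra (lie_bracket M) (L3 M)"
    and "lie_bracket M (V1 M) (V2 M) = - V2 M" "- V2 M \<noteq> 0"
    and "lie_bracket M (V1 M) (V3 M) = 0" "lie_bracket M (V2 M) (V3 M) = 0"
    and "lie_ideal (lie_bracket M) (L3 M) (L2 M)"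
    and "lie_ideal (lie_bracket M) (L3 M) (span {V3 M})"
    and "internal_direct_sum (L3 M) (L2 M) (span {V3 M})"
    and "internal_direct_sum (L3 M) (span {V3 M}) (L2 M)"
    and "L2 M \<noteq> {0}" "span {V3 M} \<noteq> {0}"
    and "dim (L3 M) = 3" "dim (L2 M) = 2"
proof -
  note [simp] = affine_field_arith(1-4) lie_bracket_affine_field[OF M(1)] affine_field_eq_iff[OF M]
  \<comment> \<open>Read from right to left, so that 0 becomes an affine field and equations with 0
    reduce to comparing parameters.\<close>
  note zero = affine_field_arith(5)[of M, symmetric]
  have sub: "subspace (L3 M)" "subspace (L2 M)" "subspace (span {V3 M})"
    by (simp_all add: L3_def L2_def)
  have L3E: "\<exists>a b c. x = affine_field M a b c" if "x \<in> L3 M" for x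
    using that by (auto simp: span_V(3))
  have [simp]: "affine_field M a b c \<in> L3 M" for a b c
    by (auto simp: span_V(3))
  show "lie_algebra (lie_bracket M) (L3 M)"
    unfolding lie_algebra_def using sub(1)
    by (auto dest!: L3E simp: affine_field_arith(5) algebra_simps)
  show "lie_bracket M (V1 M) (V2 M) = - V2 M" "- V2 M \<noteq> 0"
    "lie_bracket M (V1 M) (V3 M) = 0" "lie_bracket M (V2 M) (V3 M) = 0"
    by (simp_all add: V_affine_field zero)
  show "lie_ideal (lie_bracket M) (L3 M) (L2 M)"
    unfolding lie_ideal_def using sub(2) by (auto simp: span_V(2,3))
  show "lie_ideal (lie_bracket M) (L3 M) (span {V3 M})"
    unfolding lie_ideal_def using sub(3) by (auto simp: span_V(1,3))
  show sum: "internal_direct_sum (L3 M) (L2 M) (span {V3 M})"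
    unfolding internal_direct_sum_def
  proof (intro conjI equalityI subsetI)
    fix x assume "x \<in> L3 M"
    then obtain a b c where "x = affine_field M a b c" using L3E by blast
    then have "x = affine_field M a 0 c + affine_field M 0 b 0" by simp
    moreover have "affine_field M a 0 c \<in> L2 M" "affine_field M 0 b 0 \<in> span {V3 M}"
      unfolding span_V by auto
    ultimately show "x \<in> {x + y |x y. x \<in> L2 M \<and> y \<in> span {V3 M}}" by blast
  qed (auto simp: span_V(1,2) zero)
  show "internal_direct_sum (L3 M) (span {V3 M}) (L2 M)"
    using internal_direct_sum_commute[OF sum] .
  show "L2 M \<noteq> {0}"
    using span_base[of "V2 M" "{V1 M, V2 M}"] \<open>- V2 M \<noteq> 0\<close> by (auto simp: L2_def)
  have "V3 M \<noteq> 0" by (simp add: V_affine_field zero)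
  then show "span {V3 M} \<noteq> {0}"
    using span_base[of "V3 M" "{V3 M}"] by auto
  have "V1 M \<notin> span {V2 M}"
    by (auto simp: span_singleton V_affine_field)
  then have ind2: "independent {V1 M, V2 M}"
    using \<open>- V2 M \<noteq> 0\<close> by (simp add: independent_insert)
  have "V3 M \<notin> L2 M" by (auto simp: span_V(2)) (simp add: V_affine_field)
  then have ind3: "independent {V3 M, V1 M, V2 M}"
    using independent_insertI[OF _ ind2] by (simp add: L2_def)
  show "dim (L2 M) = 2"
    unfolding L2_def dim_span using dim_eq_card_independent[OF ind2] by (simp add: V_affine_field)
  have "L3 M = span {V3 M, V1 M, V2 M}" unfolding L3_def by (simp add: insert_commute)
  then show "dim (L3 M) = 3"
    using dim_eq_card_independent[OF ind3] by (simp add: V_affine_field)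
qed

section \<open>The symmetry condition\<close>

locale pde_setting =
  fixes \<sigma> \<rho> :: real and g :: "real \<Rightarrow> real" and J :: "real set" and M :: "point set"
  assumes \<sigma>: "\<sigma>\<^sup>2 > 0" and \<rho>: "\<rho> > 0"
    and J: "open J" "connected J" "J \<noteq> {}"
    and g: "g differentiable_on J" "deriv g differentiable_on J" "\<And>\<alpha>. \<alpha> \<in> J \<Longrightarrow> g \<alpha> \<noteq> 0"
    and M: "open M" "connected M" "M \<noteq> {}"
begin

text \<open>On the slopes p with \<open>\<rho> * p \<in> J\<close> this is the logarithmic
  derivative of \<open>g (\<rho> * p)\<close> with respect to p.\<close>

definition H :: "real \<Rightarrow> real"
  where "H p = \<rho> * (deriv g (\<rho> * p) / g (\<rho> * p))"

lemma g_derivative: "\<alpha> \<in> J \<Longrightarrow> (g has_real_derivative deriv g \<alpha>) (at \<alpha>)"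
  using g(1) J(1) by (metis DERIV_imp_deriv differentiable_on_eq_differentiable_at real_differentiable_def)

lemma H_derivative:
  assumes "\<rho> * p \<in> J"
  shows "(H has_real_derivative deriv H p) (at p)"
proof -
  obtain g2 where g2: "(deriv g has_real_derivative g2) (at (\<rho> * p))"
    using g(2) J(1) assms by (metis differentiable_on_eq_differentiable_at real_differentiable_def)
  have m: "((\<lambda>p. \<rho> * p) has_real_derivative \<rho>) (at p)"
    by (auto intro!: derivative_eq_intros)
  have "\<exists>D. (H has_real_derivative D) (at p)"
    unfolding H_def[abs_def]
    by (rule exI DERIV_cmult DERIV_divide DERIV_chain2[OF g2 m]
      DERIV_chain2[OF g_derivative[OF assms] m] g(3)[OF assms])+
  then show ?thesis by (metis DERIV_imp_deriv)
qed

lemma pde_lhs_H: "pde_lhs \<sigma> \<rho> g (S, t, u, p, q, r, s, w)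
    = q + \<sigma>\<^sup>2 / 2 * (S\<^sup>2 * r) / (1 - H p * S * r)\<^sup>2"
  by (simp add: H_def)

lemma prolongation2_apply_H:
  assumes "\<rho> * p \<in> J" "1 - H p * S * r \<noteq> 0" and j: "j = (S, t, u, p, q, r, s, w)"
  shows "prolongation2_apply V (pde_lhs \<sigma> \<rho> g) j =
    prolong_t V j + \<sigma>\<^sup>2 / 2 * ((2 * S * xi_coeff V (S, t, u) * r + S\<^sup>2 * prolong_SS V j) * (1 - H p * S * r)
      + 2 * S\<^sup>2 * r * (deriv H p * prolong_S V j * S * r + H p * xi_coeff V (S, t, u) * r
        + H p * S * prolong_SS V j)) / (1 - H p * S * r) ^ 3"
  unfolding prolongation2_apply_def prolongation2_def
  using pde_lhs_derivative[OF H_def H_derivative[OF assms(1)] refl assms(2)] j by simp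

text \<open>The flows are translations in t and u and a common scaling of S and u. Under the scaling
  u_S is invariant, u_t has weight 1 and u_SS has weight -1, so the prolonged field maps the
  left-hand side of the equation to \<open>a\<close> times itself.\<close>

lemma affine_field_symmetry: "affine_field M a b c \<in> pde_symmetry_algebra M J \<sigma> \<rho> g"
proof -
  define V where "V = affine_field M a b c"
  have smooth: "V \<in> smooth_vfields M"
  proof -
    have "Ck_on k M V" for k
    proof -
      have "Ck_on k M (\<lambda>x. (a * fst x, 0, a * snd (snd x)) + (0, b, c))"
        by (rule Ck_on_affine[OF bounded_linear_coordinates(3)])
      then show ?thesis
        by (subst Ck_on_cong[OF M(1), of V "\<lambda>x. (a * fst x, 0, a * snd (snd x)) + (0, b, c)"])
          (simp_all add: V_def affine_field_decompose)
    qed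
    then show ?thesis by (simp add: smooth_vfields_def V_def affine_field_apply)
  qed
  interpret smooth_vfield M V by unfold_locales (fact M smooth)+
  \<comment> \<open>The zero summands keep the shape \<open>L y + c\<close> required by
    \<open>frechet_derivative_affine\<close>.\<close>
  have coeffs: "\<xi> x = a * fst x + 0" "\<tau> x = 0 + b" "\<phi> x = a * snd (snd x) + c" if "x \<in> M" for x
    using that by (simp_all add: xi_coeff_def tau_coeff_def phi_coeff_def V_def affine_field_apply)
  have partials: "partial v \<xi> x = a * fst v + 0" "partial v \<tau> x = 0 + 0" "partial v \<phi> x = a * snd (snd v) + 0" if "x \<in> M" for v x
    using fun_cong[OF frechet_derivative_affine[OF M(1) that bounded_linear_coordinates(1) coeffs(1)], where x=v]
      fun_cong[OF frechet_derivative_affine[OF M(1) that bounded_linear_zero coeffs(2)], where x=v]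
      fun_cong[OF frechet_derivative_affine[OF M(1) that bounded_linear_coordinates(2) coeffs(3)], where x=v]
    by (simp_all add: partial_def)
  have const: "partial v f x = 0" if "x \<in> M" "\<And>y. y \<in> M \<Longrightarrow> f y = k" for v f x k
    using partial_cong[OF M(1) that(1), of f "\<lambda>_. k"] that by (simp add: partial_def)
  have partials2: "partial w (partial v \<xi>) x = 0" "partial w (partial v \<tau>) x = 0"
    "partial w (partial v \<phi>) x = 0" if "x \<in> M" for v w x
    using const[OF that partials(1)] const[OF that partials(2)] const[OF that partials(3)] by simp_all
  have "prolongation2_apply V (pde_lhs \<sigma> \<rho> g) j = 0"
    if jU: "j \<in> pde_domain M J \<rho> g" and zero: "pde_lhs \<sigma> \<rho> g j = 0" for j
  proof -
    obtain S t u p q r s w where j: "j = (S, t, u, p, q, r, s, w)" by (metis prod.exhaust)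
    have U: "(S, t, u) \<in> M" "\<rho> * p \<in> J" "1 - H p * S * r \<noteq> 0"
      using jU by (simp_all add: pde_domain_def j H_def)
    have pS: "prolong_S V j = 0" and pt: "prolong_t V j = a * q"
      using prolong_S_coordinates[of j] prolong_t_coordinates[of j] U(1) partials[OF U(1)] by (simp_all add: j)
    have pSS: "prolong_SS V j = - a * r"
      unfolding prolong_SS_coordinates[OF refl U(1) j]
      using partials[OF U(1)] partials2[OF U(1)] by simp
    have q: "q = - (\<sigma>\<^sup>2 / 2 * (S\<^sup>2 * r) / (1 - H p * S * r)\<^sup>2)"
      using zero unfolding j pde_lhs_H by simp
    define D where "D = 1 - H p * S * r"
    have "(2 * S * (a * S + 0) * r + S\<^sup>2 * (- a * r)) * D
        + 2 * S\<^sup>2 * r * (deriv H p * 0 * S * r + H p * (a * S + 0) * r + H p * S * (- a * r))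
        = a * S\<^sup>2 * r * D"
      by (simp add: algebra_simps power2_eq_square)
    then show ?thesis
      using U(3) unfolding prolongation2_apply_H[OF U(2,3) j] pS pt pSS coeffs(1)[OF U(1)] q D_def[symmetric]
      by (simp add: field_simps power2_eq_square power3_eq_cube)
  qed
  then show ?thesis
    using smooth unfolding pde_symmetry_algebra_def symmetry_algebra_def V_def by blast
qed

text \<open>If H vanished throughout, g would be constant, which is an exponential with exponent
  0.\<close>

lemma H_not_identically_zero:
  assumes "\<not> special_form J \<rho> g"
  shows "\<exists>p. \<rho> * p \<in> J \<and> H p \<noteq> 0"
proof (rule ccontr)
  assume *: "\<not> ?thesis"
  have "deriv g y = 0" if "y \<in> J" for y
    using * that \<rho> g(3)[OF that] by (auto simp: H_def dest!: spec[of _ "y / \<rho>"])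
  then have "special_form J \<rho> g"
    using special_form_if_first_integral[of J g "deriv g" \<rho> 1 0 0] J g_derivative g(3) \<rho> by auto
  then show False using assms by simp
qed

text \<open>The left-hand side of \<open>ode\<close> is the derivative of
  \<open>H p * (\<alpha> + \<beta> * p)\<close>. This product is therefore a constant C, and
  multiplication by g gives the linear equation treated in
  \<open>special_form_if_first_integral\<close>.\<close>

lemma special_form_if_ode:
  assumes ode: "\<And>p. \<rho> * p \<in> J \<Longrightarrow> \<beta> * H p + deriv H p * (\<alpha> + \<beta> * p) = 0"
    and nz: "\<alpha> \<noteq> 0 \<or> \<beta> \<noteq> 0"
  shows "special_form J \<rho> g"
proof -
  have "((\<lambda>y. H (y / \<rho>) * (\<alpha> + \<beta> * (y / \<rho>))) has_real_derivative 0) (at y)" if "y \<in> J" for y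
  proof -
    have p: "\<rho> * (y / \<rho>) \<in> J" using that \<rho> by simp
    have m: "((\<lambda>y. y / \<rho>) has_real_derivative 1 / \<rho>) (at y)"
      using \<rho> by (auto intro!: derivative_eq_intros)
    have l: "((\<lambda>y. \<alpha> + \<beta> * (y / \<rho>)) has_real_derivative \<beta> * (1 / \<rho>)) (at y)"
      using \<rho> by (auto intro!: derivative_eq_intros)
    have "((\<lambda>y. H (y / \<rho>) * (\<alpha> + \<beta> * (y / \<rho>))) has_real_derivative
        deriv H (y / \<rho>) * (1 / \<rho>) * (\<alpha> + \<beta> * (y / \<rho>)) + \<beta> * (1 / \<rho>) * H (y / \<rho>)) (at y)"
      by (rule DERIV_mult[OF DERIV_chain2[OF H_derivative[OF p] m] l])
    moreover have "deriv H (y / \<rho>) * (1 / \<rho>) * (\<alpha> + \<beta> * (y / \<rho>)) + \<beta> * (1 / \<rho>) * H (y / \<rho>) = 0"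
      using ode[OF p] \<rho> by (simp add: field_simps)
    ultimately show ?thesis by simp
  qed
  from constant_if_derivative_zero[OF J(1,2) this]
  obtain C where C: "\<And>y. y \<in> J \<Longrightarrow> H (y / \<rho>) * (\<alpha> + \<beta> * (y / \<rho>)) = C" by blast
  show ?thesis
  proof (rule special_form_if_first_integral[OF J(1,2) g_derivative _ _ nz \<rho> g(3)])
    fix y assume y: "y \<in> J"
    have "\<rho> * \<alpha> + \<beta> * y = \<rho> * (\<alpha> + \<beta> * (y / \<rho>))"
      using \<rho> by (simp add: field_simps)
    then show "deriv g y * (\<rho> * \<alpha> + \<beta> * y) = C * g y"
      using C[OF y] g(3)[OF y] \<rho> by (auto simp: H_def)
    \<comment> \<open>Where the linear factor vanishes, \<open>ode\<close> reduces to
      \<open>\<beta> * H p = 0\<close>.\<close>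
    assume 0: "\<rho> * \<alpha> + \<beta> * y = 0"
    then have "\<beta> \<noteq> 0" using nz \<rho> by auto
    moreover have "\<alpha> + \<beta> * (y / \<rho>) = 0" using 0 \<rho> by (simp add: field_simps)
    ultimately have "H (y / \<rho>) = 0" using ode[of "y / \<rho>"] y \<rho> by simp
    then show "deriv g y = 0" using \<rho> g(3)[OF y] by (simp add: H_def)
  qed
qed

text \<open>Both sets are open and non-empty, the second by continuity of H. They are the sets on
  which coefficients of powers of p are compared.\<close>

lemma infinite_slopes: "infinite {p. \<rho> * p \<in> J}"
  and infinite_slopes_H: "\<not> special_form J \<rho> g \<Longrightarrow> infinite {p. \<rho> * p \<in> J \<and> H p \<noteq> 0}"
proof -
  have op: "open {p. \<rho> * p \<in> J}"
    using continuous_open_vimage[OF J(1), of "\<lambda>p. \<rho> * p"] by (simp add: vimage_def)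
  obtain y where "y \<in> J" using J(3) by blast
  then have "\<rho> * (y / \<rho>) \<in> J" using \<rho> by simp
  then have "{p. \<rho> * p \<in> J} \<noteq> {}" by blast
  then show "infinite {p. \<rho> * p \<in> J}"
    using op finite_imp_not_open by blast
  assume "\<not> special_form J \<rho> g"
  then have ne: "{p. \<rho> * p \<in> J \<and> H p \<noteq> 0} \<noteq> {}" using H_not_identically_zero by auto
  have "continuous_on {p. \<rho> * p \<in> J} H"
    by (intro DERIV_continuous_on) (auto intro: has_field_derivative_at_within H_derivative)
  then have "open ({p. \<rho> * p \<in> J} \<inter> H -` (- {0}))"
    using op by (intro continuous_open_preimage) auto
  moreover have "{p. \<rho> * p \<in> J} \<inter> H -` (- {0}) = {p. \<rho> * p \<in> J \<and> H p \<noteq> 0}" by auto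
  ultimately show "infinite {p. \<rho> * p \<in> J \<and> H p \<noteq> 0}"
    using ne finite_imp_not_open by metis
qed

end

section \<open>The determining equations\<close>

locale generic_symmetry = pde_setting \<sigma> \<rho> g J M + smooth_vfield M V for \<sigma> \<rho> g J M V +
  assumes sym: "V \<in> pde_symmetry_algebra M J \<sigma> \<rho> g"
    and generic: "\<not> special_form J \<rho> g"
begin

text \<open>The determining equations carry powers of S, which can be cancelled only here.\<close>

definition M0 :: "point set"
  where "M0 = {x \<in> M. fst x \<noteq> 0}"

lemma open_M0: "open M0"
proof -
  have "open ((fst :: point \<Rightarrow> real) -` (- {0}))"
    by (intro continuous_open_vimage) (auto intro: continuous_fst)
  moreover have "M0 = M \<inter> fst -` (- {0})" by (auto simp: M0_def)
  ultimately show ?thesis using M(1) by auto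
qed

text \<open>Solving the equation for u_t parametrizes its solution set in the jet space; all the
  other coordinates remain free within the domain.\<close>

lemma symmetry_equation:
  assumes x: "(S, t, u) \<in> M" and p: "\<rho> * p \<in> J" and D: "1 - H p * S * r \<noteq> 0"
    and q: "q = - (\<sigma>\<^sup>2 / 2 * (S\<^sup>2 * r) / (1 - H p * S * r)\<^sup>2)"
    and j: "j = (S, t, u, p, q, r, s, w)"
  shows "prolong_t V j + \<sigma>\<^sup>2 / 2 * ((2 * S * \<xi> (S, t, u) * r + S\<^sup>2 * prolong_SS V j) * (1 - H p * S * r)
      + 2 * S\<^sup>2 * r * (deriv H p * prolong_S V j * S * r + H p * \<xi> (S, t, u) * r
        + H p * S * prolong_SS V j)) / (1 - H p * S * r) ^ 3 = 0"
proof -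
  have "j \<in> pde_domain M J \<rho> g"
    using x p D by (simp add: pde_domain_def j H_def)
  moreover have "pde_lhs \<sigma> \<rho> g j = 0"
    unfolding j pde_lhs_H q by simp
  ultimately have "prolongation2_apply V (pde_lhs \<sigma> \<rho> g) j = 0"
    using sym by (auto simp: pde_symmetry_algebra_def symmetry_algebra_def)
  then show ?thesis unfolding prolongation2_apply_H[OF p D j] .
qed

text \<open>The coefficient of \<open>u\<^sub>S\<^sub>t\<close>, read off at \<open>u\<^sub>S\<^sub>S = 0\<close>.\<close>

lemma tau_S_u:
  assumes "x \<in> M0"
  shows "dS \<tau> x = 0" "du \<tau> x = 0"
proof -
  obtain S t u where x: "x = (S, t, u)" by (metis prod.exhaust)
  have xM: "(S, t, u) \<in> M" and S: "S \<noteq> 0" using assms by (auto simp: M0_def x)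
  have "dS \<tau> x + du \<tau> x * p = 0" if p: "p \<in> {p. \<rho> * p \<in> J}" for p
  proof -
    \<comment> \<open>With u_SS = u_t = 0 the equation holds for every value \<open>s\<close> of
      u_St, and \<open>prolong_SS\<close> is the only term of the condition that depends on
      \<open>s\<close>.\<close>
    define j where "j s = (S, t, u, p, 0 :: real, 0 :: real, s, 0 :: real)" for s :: real
    have "prolong_t V (j s) + \<sigma>\<^sup>2 / 2 * (S\<^sup>2 * prolong_SS V (j s)) = 0" for s
      using symmetry_equation[OF xM, of p 0 0 "j s" s 0] p by (simp add: j_def)
    moreover have "prolong_t V (j 0) = prolong_t V (j 1)"
      by (simp add: prolong_t_coordinates j_def xM)
    ultimately have "\<sigma>\<^sup>2 / 2 * (S\<^sup>2 * prolong_SS V (j 0)) = \<sigma>\<^sup>2 / 2 * (S\<^sup>2 * prolong_SS V (j 1))"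
      by (metis add_left_cancel)
    then have "prolong_SS V (j 0) = prolong_SS V (j 1)" using S \<sigma> by simp
    then show ?thesis
      unfolding j_def prolong_SS_coordinates[OF refl xM refl] by (simp add: x algebra_simps)
  qed
  from linear_coeffs_zero[OF infinite_slopes this]
  show "dS \<tau> x = 0" "du \<tau> x = 0" by simp_all
qed

text \<open>Since \<open>M0\<close> is open, identities on it may be differentiated.\<close>

lemma zero_on_M0:
  assumes "\<And>x. x \<in> M0 \<Longrightarrow> f x = 0" "x \<in> M0"
  shows "partial v f x = 0"
  using partial_zero[OF open_M0 assms(2,1)] .

lemma mixed:
  assumes "smooth_fun M f" "x \<in> M"
  shows "dS (du f) x = du (dS f) x" "dS (dt f) x = dt (dS f) x"
  using partial_commute[OF open_M assms(2,1)] by (auto simp: point_Basis)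

text \<open>Because \<tau> depends on neither S nor u, \<open>prolong_S\<close> is \<open>B\<close>,
  \<open>prolong_t\<close> is \<open>E + q * G\<close> and \<open>prolong_SS\<close> is
  \<open>A + C * r\<close>. Multiplication by the cube of the denominator gives a cubic in r = u_SS,
  and each of the four claims is the vanishing of one of its coefficients.\<close>

lemma determining_polynomial:
  assumes x: "x = (S, t, u)" "x \<in> M0" and p: "\<rho> * p \<in> J"
  defines "A \<equiv> dS (dS \<phi>) x + (2 * du (dS \<phi>) x - dS (dS \<xi>) x) * p
      + (du (du \<phi>) x - 2 * du (dS \<xi>) x) * p\<^sup>2 + (- du (du \<xi>) x) * p ^ 3"
    and "B \<equiv> dS \<phi> x + (du \<phi> x - dS \<xi> x) * p - du \<xi> x * p\<^sup>2"
    and "C \<equiv> du \<phi> x - 2 * dS \<xi> x - 3 * du \<xi> x * p"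
    and "E \<equiv> dt \<phi> x - dt \<xi> x * p"
    and "G \<equiv> du \<phi> x - dt \<tau> x - du \<xi> x * p"
  shows "E + \<sigma>\<^sup>2 / 2 * S\<^sup>2 * A = 0"
    and "\<sigma>\<^sup>2 / 2 * (2 * S * \<xi> x + S\<^sup>2 * (C - G) + S ^ 3 * H p * A) - 3 * H p * S * E = 0"
    and "3 * (H p)\<^sup>2 * S\<^sup>2 * E + \<sigma>\<^sup>2 / 2 * S ^ 3 * (H p * (C + G) + 2 * deriv H p * B) = 0"
    and "H p ^ 3 * S ^ 3 * E = 0"
proof -
  have xM: "(S, t, u) \<in> M" and S: "S \<noteq> 0" using x(2) by (auto simp: M0_def x(1))
  have \<tau>0: "dS \<tau> x = 0" "du \<tau> x = 0" "dS (dS \<tau>) x = 0" "du (dS \<tau>) x = 0"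
    "dS (du \<tau>) x = 0" "du (du \<tau>) x = 0"
    using tau_S_u x(2) zero_on_M0[OF tau_S_u(1)] zero_on_M0[OF tau_S_u(2)] by auto
  have mix: "dS (du \<phi>) x = du (dS \<phi>) x" "dS (du \<xi>) x = du (dS \<xi>) x"
    using mixed(1) smooth_coeffs xM x(1) by auto
  define \<kappa> where "\<kappa> = \<sigma>\<^sup>2 / 2"
  define c0 c1 c2 c3 where "c0 = E + \<kappa> * S\<^sup>2 * A"
    and "c1 = \<kappa> * (2 * S * \<xi> x + S\<^sup>2 * (C - G) + S ^ 3 * H p * A) - 3 * H p * S * E"
    and "c2 = 3 * (H p)\<^sup>2 * S\<^sup>2 * E + \<kappa> * S ^ 3 * (H p * (C + G) + 2 * deriv H p * B)"
    and "c3 = - (H p ^ 3 * S ^ 3 * E)"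
  have *: "c0 + c1 * r + c2 * r\<^sup>2 + c3 * r ^ 3 = 0" if r: "r \<in> {r. 1 - H p * S * r \<noteq> 0}" for r
  proof -
    define D where "D = 1 - H p * S * r"
    have D: "D \<noteq> 0" using r by (simp add: D_def)
    define q where "q = - (\<kappa> * (S\<^sup>2 * r) / D\<^sup>2)"
    define j where "j = (S, t, u, p, q, r, 0 :: real, 0 :: real)"
    have pS: "prolong_S V j = B"
      using prolong_S_coordinates[of j] xM \<tau>0 by (simp add: j_def B_def x(1) algebra_simps power2_eq_square)
    have pt: "prolong_t V j = E + q * G"
      using prolong_t_coordinates[of j] xM \<tau>0 by (simp add: j_def E_def G_def x(1) algebra_simps)
    have pSS: "prolong_SS V j = A + C * r"
      unfolding prolong_SS_coordinates[OF x(1) xM[folded x(1)] j_def] \<tau>0 mix A_def C_def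
      by (simp add: algebra_simps power2_eq_square power3_eq_cube)
    define N where "N = (2 * S * \<xi> x * r + S\<^sup>2 * (A + C * r)) * D
      + 2 * S\<^sup>2 * r * (deriv H p * B * S * r + H p * \<xi> x * r + H p * S * (A + C * r))"
    have "E + q * G + \<kappa> * N / D ^ 3 = 0"
      using symmetry_equation[OF xM p D[unfolded D_def] q_def[unfolded D_def \<kappa>_def] j_def]
      unfolding \<kappa>_def[symmetric] pS pt pSS N_def D_def x(1) .
    then have "(E + q * G + \<kappa> * N / D ^ 3) * D ^ 3 = 0" by simp
    moreover have "(E + q * G + \<kappa> * N / D ^ 3) * D ^ 3
        = E * D ^ 3 - \<kappa> * S\<^sup>2 * r * G * D + \<kappa> * N"
      using D by (simp add: q_def field_simps power2_eq_square power3_eq_cube)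
    ultimately have "E * D ^ 3 - \<kappa> * S\<^sup>2 * r * G * D + \<kappa> * N = 0" by metis
    then show ?thesis
      unfolding N_def D_def c0_def c1_def c2_def c3_def
      by (simp add: algebra_simps power2_eq_square power3_eq_cube)
  qed
  \<comment> \<open>The excluded values of r are roots of a polynomial with constant term 1, hence
    finitely many.\<close>
  have "{r. 1 - H p * S * r \<noteq> 0} = - {r. poly [:1, - (H p * S):] r = 0}"
    by (auto simp: algebra_simps)
  moreover have "finite {r. poly [:1, - (H p * S):] r = 0}"
    by (intro poly_roots_finite) simp
  ultimately have "infinite {r. 1 - H p * S * r \<noteq> 0}"
    using infinite_UNIV_char_0 by (metis Compl_eq_Diff_UNIV finite_Diff2)
  from cubic_coeffs_zero[OF this *]
  show "E + \<sigma>\<^sup>2 / 2 * S\<^sup>2 * A = 0"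
    and "\<sigma>\<^sup>2 / 2 * (2 * S * \<xi> x + S\<^sup>2 * (C - G) + S ^ 3 * H p * A) - 3 * H p * S * E = 0"
    and "3 * (H p)\<^sup>2 * S\<^sup>2 * E + \<sigma>\<^sup>2 / 2 * S ^ 3 * (H p * (C + G) + 2 * deriv H p * B) = 0"
    and "H p ^ 3 * S ^ 3 * E = 0"
    by (simp_all add: \<kappa>_def c0_def c1_def c2_def c3_def)
qed

text \<open>The coefficients in u_SS are used in the order 3, 0, 1, 2. Where H is non-zero the cubic
  one removes \<open>E\<close>, the constant one then gives \<open>A = 0\<close>, the linear one
  determines \<xi>, and the quadratic one becomes the classifying equation.\<close>

lemma determining_equations:
  assumes "x \<in> M0"
  shows "dt \<phi> x = 0" "dt \<xi> x = 0" "du \<xi> x = 0"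
    "dS (dS \<phi>) x = 0" "2 * du (dS \<phi>) x = dS (dS \<xi>) x"
    "2 * \<xi> x + fst x * (dt \<tau> x - 2 * dS \<xi> x) = 0"
    "\<rho> * p \<in> J \<Longrightarrow> H p * (2 * du \<phi> x - 2 * dS \<xi> x - dt \<tau> x)
       + 2 * deriv H p * (dS \<phi> x + (du \<phi> x - dS \<xi> x) * p) = 0"
proof -
  obtain S t u where x: "x = (S, t, u)" by (metis prod.exhaust)
  have S: "S \<noteq> 0" using assms by (auto simp: M0_def x)
  note poly = determining_polynomial[OF x assms]
  have "dt \<phi> x + (- dt \<xi> x) * p = 0" if "p \<in> {p. \<rho> * p \<in> J \<and> H p \<noteq> 0}" for p
    using poly(4)[of p] that S by simp
  from linear_coeffs_zero[OF infinite_slopes_H[OF generic] this]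
  show t: "dt \<phi> x = 0" "dt \<xi> x = 0" by simp_all
  let ?A = "\<lambda>p. dS (dS \<phi>) x + (2 * du (dS \<phi>) x - dS (dS \<xi>) x) * p
      + (du (du \<phi>) x - 2 * du (dS \<xi>) x) * p\<^sup>2 + (- du (du \<xi>) x) * p ^ 3"
  have A: "?A p = 0" if "p \<in> {p. \<rho> * p \<in> J}" for p
    using poly(1)[of p] that S \<sigma> t by simp
  from cubic_coeffs_zero[OF infinite_slopes this]
  show "dS (dS \<phi>) x = 0" "2 * du (dS \<phi>) x = dS (dS \<xi>) x" by simp_all
  have "(2 * \<xi> x + S * (dt \<tau> x - 2 * dS \<xi> x)) + (- (2 * S * du \<xi> x)) * p = 0"
    if p: "p \<in> {p. \<rho> * p \<in> J}" for p
  proof -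
    have "\<sigma>\<^sup>2 / 2 * (S * ((2 * \<xi> x + S * (dt \<tau> x - 2 * dS \<xi> x)) + (- (2 * S * du \<xi> x)) * p)) = 0"
      using poly(2)[of p, unfolded A[OF p]] p t by (simp add: algebra_simps power2_eq_square)
    then show ?thesis using \<sigma> S by simp
  qed
  from linear_coeffs_zero[OF infinite_slopes this]
  show u: "du \<xi> x = 0" and "2 * \<xi> x + fst x * (dt \<tau> x - 2 * dS \<xi> x) = 0"
    using S by (simp_all add: x)
  show "H p * (2 * du \<phi> x - 2 * dS \<xi> x - dt \<tau> x)
       + 2 * deriv H p * (dS \<phi> x + (du \<phi> x - dS \<xi> x) * p) = 0" if "\<rho> * p \<in> J"
  proof -
    have "H p * (du \<phi> x - 2 * dS \<xi> x + (du \<phi> x - dt \<tau> x))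
       + 2 * deriv H p * (dS \<phi> x + (du \<phi> x - dS \<xi> x) * p) = 0"
      using poly(3)[OF that] t u S \<sigma> by simp
    then show ?thesis by (simp add: algebra_simps)
  qed
qed

text \<open>Differentiating \<open>2 \<xi> + S (\<tau>\<^sub>t - 2 \<xi>\<^sub>S) = 0\<close> and its consequence \<open>\<tau>\<^sub>t = 4 S \<phi>\<^bsub>Su\<^esub>\<close> with respect
  to \<open>S\<close> forces \<open>\<tau>\<^sub>t = 0\<close>.\<close>

lemma tau_t:
  assumes x: "x \<in> M0"
  shows "dt \<tau> x = 0" "dS (dS \<xi>) x = 0"
proof -
  have inM: "y \<in> M" if "y \<in> M0" for y using that by (simp add: M0_def)
  note sm = smooth_coeffs smooth_coeffs[THEN smooth_partial(1)] smooth_coeffs(2)[THEN smooth_partial(2)]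
    smooth_coeffs(3)[THEN smooth_partial(1), THEN smooth_partial(3)]
  note d = sm[THEN diff]
  have tau: "dt \<tau> y = 4 * fst y * du (dS \<phi>) y" if y: "y \<in> M0" for y
  proof -
    \<comment> \<open>The factors 1 and -2 are written out to match
      \<open>partial_linear_combination\<close>.\<close>
    have "dS (\<lambda>x. 2 * \<xi> x + 1 * (fst x * (1 * dt \<tau> x + (- 2) * dS \<xi> x))) y = 0"
      using determining_equations(6) by (intro zero_on_M0[OF _ y]) simp
    moreover have dd: "(\<lambda>x. 1 * dt \<tau> x + (- 2) * dS \<xi> x) differentiable (at y)"
      using d inM[OF y] by (intro derivative_intros) auto
    ultimately have "2 * dS \<xi> y + (fst y * (dS (dt \<tau>) y - 2 * dS (dS \<xi>) y) + (dt \<tau> y - 2 * dS \<xi> y)) = 0"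
      unfolding partial_linear_combination[OF d(1)[OF inM[OF y]] partial_fst_mult(1)[OF dd]]
        partial_fst_mult(2)[OF dd] partial_linear_combination[OF d(7,4)[OF inM[OF y]]]
      by simp
    moreover have "dS (dt \<tau>) y = 0"
      using mixed(2)[OF sm(2) inM[OF y]] zero_on_M0[OF tau_S_u(1) y] by simp
    moreover note determining_equations(5)[OF y]
    ultimately show ?thesis by (simp add: algebra_simps)
  qed
  \<comment> \<open>In the S-derivative of \<tau>_t = 4 S \<phi>_Su the terms \<tau>_tS and
    \<phi>_SuS vanish, which leaves \<phi>_Su = 0.\<close>
  have "dS (\<lambda>x. 1 * dt \<tau> x + (- 4) * (fst x * du (dS \<phi>) x)) x = 0"
    using tau by (intro zero_on_M0[OF _ x]) simp
  then have "dS (dt \<tau>) x + (- 4) * (fst x * dS (du (dS \<phi>)) x + du (dS \<phi>) x) = 0"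
    unfolding partial_linear_combination[OF d(7)[OF inM[OF x]] partial_fst_mult(1)[OF d(8)[OF inM[OF x]]]]
      partial_fst_mult(2)[OF d(8)[OF inM[OF x]]]
    by simp
  moreover have "dS (dt \<tau>) x = 0"
    using mixed(2)[OF sm(2) inM[OF x]] zero_on_M0[OF tau_S_u(1) x] by simp
  moreover have "dS (du (dS \<phi>)) x = 0"
    using mixed(1)[OF sm(6) inM[OF x]] zero_on_M0[OF determining_equations(4) x] by simp
  ultimately have "du (dS \<phi>) x = 0" by simp
  then show "dt \<tau> x = 0" "dS (dS \<xi>) x = 0"
    using tau[OF x] determining_equations(5)[OF x] by simp_all
qed

text \<open>With \<tau>_t = 0 the classifying equation holds at every admissible slope, so a
  non-zero pair of coefficients would make g special.\<close>

lemma phi_S_u: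
  assumes "x \<in> M0"
  shows "dS \<phi> x = 0" "du \<phi> x - dS \<xi> x = 0"
proof -
  have "(du \<phi> x - dS \<xi> x) * H p + deriv H p * (dS \<phi> x + (du \<phi> x - dS \<xi> x) * p) = 0"
    if "\<rho> * p \<in> J" for p
    using determining_equations(7)[OF assms that] tau_t(1)[OF assms] by (simp add: algebra_simps)
  then show "dS \<phi> x = 0" "du \<phi> x - dS \<xi> x = 0"
    using special_form_if_ode[of "du \<phi> x - dS \<xi> x" "dS \<phi> x"] generic by blast+
qed

text \<open>\<open>M0\<close> is dense in \<open>M\<close>.\<close>

lemma extend_from_M0:
  fixes f :: "point \<Rightarrow> real"
  assumes "continuous_on M f" "\<And>x. x \<in> M0 \<Longrightarrow> f x = 0" "x \<in> M"
  shows "f x = 0"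
proof (rule ccontr)
  assume "f x \<noteq> 0"
  then have "x \<in> M \<inter> f -` (- {0})" using assms(3) by simp
  moreover have "open (M \<inter> f -` (- {0}))"
    using assms(1) M(1) by (intro continuous_open_preimage) auto
  ultimately obtain y where "y \<in> M \<inter> f -` (- {0})" "fst y \<noteq> 0"
    using open_nonzero_fst by blast
  then show False using assms(2)[of y] by (auto simp: M0_def)
qed

text \<open>The three parameters are the constant values of \<xi>_S, of \<tau> and of \<phi> - a u
  on the connected set \<open>M\<close>.\<close>

lemma symmetry_in_L3: "V \<in> L3 M"
proof -
  have inM: "y \<in> M" if "y \<in> M0" for y using that by (simp add: M0_def)
  have cont: "continuous_on M f" if "smooth_fun M f" for f
    using smooth_fun_continuous[OF that] .
  note sm = smooth_coeffs smooth_coeffs[THEN smooth_partial(1)] smooth_coeffs[THEN smooth_partial(2)]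
    smooth_coeffs[THEN smooth_partial(3)]
  have zero: "f x = 0" if "smooth_fun M f" "\<And>x. x \<in> M0 \<Longrightarrow> f x = 0" "x \<in> M" for f x
    using extend_from_M0[OF cont[OF that(1)] that(2,3)] by simp
  have "dS (dS \<xi>) x = 0" "dt (dS \<xi>) x = 0" "du (dS \<xi>) x = 0" if "x \<in> M" for x
  proof -
    show "dS (dS \<xi>) x = 0"
      using zero[OF smooth_partial(1)[OF sm(4)] tau_t(2) that] .
    show "dt (dS \<xi>) x = 0"
    proof (rule zero[OF smooth_partial(2)[OF sm(4)] _ that])
      fix y assume y: "y \<in> M0"
      show "dt (dS \<xi>) y = 0"
        using mixed(2)[OF sm(1) inM[OF y]] zero_on_M0[OF determining_equations(2) y] by simp
    qed
    show "du (dS \<xi>) x = 0"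
    proof (rule zero[OF smooth_partial(3)[OF sm(4)] _ that])
      fix y assume y: "y \<in> M0"
      show "du (dS \<xi>) y = 0"
        using mixed(1)[OF sm(1) inM[OF y]] zero_on_M0[OF determining_equations(3) y] by simp
    qed
  qed
  then obtain a where a: "\<And>x. x \<in> M \<Longrightarrow> dS \<xi> x = a"
    using constant_if_partials_zero[OF M(1,2), of "dS \<xi>"] diff[OF sm(4)] by blast
  \<comment> \<open>With \<tau>_t = 0 the sixth determining equation reads \<xi> = S \<xi>_S, so no
    constant of integration appears.\<close>
  have \<xi>: "\<xi> x = a * fst x" if "x \<in> M" for x
  proof -
    have "\<xi> x - a * fst x = 0"
    proof (rule extend_from_M0[of "\<lambda>x. \<xi> x - a * fst x", OF _ _ that])
      show "continuous_on M (\<lambda>x. \<xi> x - a * fst x)"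
        by (intro continuous_on_diff cont[OF sm(1)] continuous_on_mult_left continuous_on_fst
          continuous_on_id)
      show "\<xi> x - a * fst x = 0" if "x \<in> M0" for x
        using determining_equations(6)[OF that] tau_t(1)[OF that] a[OF inM[OF that]] by simp
    qed
    then show ?thesis by simp
  qed
  have "dS \<tau> x = 0" "dt \<tau> x = 0" "du \<tau> x = 0" if "x \<in> M" for x
    using zero[OF sm(5) tau_S_u(1) that] zero[OF sm(8) tau_t(1) that] zero[OF sm(11) tau_S_u(2) that]
    by auto
  then obtain b where b: "\<And>x. x \<in> M \<Longrightarrow> \<tau> x = b"
    using constant_if_partials_zero[OF M(1,2), of \<tau>] diff[OF sm(2)] by blast
  define h where "h x = 1 * \<phi> x + (- a) * snd (snd x)" for x
  have snd_diff: "(\<lambda>x::point. snd (snd x)) differentiable (at x)"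
    and snd_partial: "partial v (\<lambda>x::point. snd (snd x)) x = snd (snd v)" for v x
  proof -
    have D: "((\<lambda>x::point. snd (snd x)) has_derivative (\<lambda>v. snd (snd v))) (at x)"
      by (intro has_derivative_snd has_derivative_ident)
    then show "(\<lambda>x::point. snd (snd x)) differentiable (at x)"
      unfolding differentiable_def by blast
    show "partial v (\<lambda>x::point. snd (snd x)) x = snd (snd v)"
      unfolding partial_def frechet_derivative_at[OF D, symmetric] ..
  qed
  have h: "partial v h x = partial v \<phi> x - a * snd (snd v)" if "x \<in> M" for v x
    unfolding h_def[abs_def] partial_linear_combination[OF diff[OF sm(3) that] snd_diff] snd_partial
    by simp
  have "du \<phi> x - a = 0" if "x \<in> M" for x
  proof (rule extend_from_M0[of "\<lambda>x. du \<phi> x - a", OF _ _ that])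
    show "continuous_on M (\<lambda>x. du \<phi> x - a)"
      by (rule continuous_on_diff[OF cont[OF sm(12)] continuous_on_const])
    show "du \<phi> x - a = 0" if "x \<in> M0" for x
      using phi_S_u(2)[OF that] a[OF inM[OF that]] by simp
  qed
  then have "dS h x = 0" "dt h x = 0" "du h x = 0" if "x \<in> M" for x
    using zero[OF sm(6) phi_S_u(1) that] zero[OF sm(9) determining_equations(1) that] that
    by (auto simp: h)
  moreover have "h differentiable (at x)" if "x \<in> M" for x
    unfolding h_def[abs_def] using diff[OF sm(3) that] snd_diff by (intro derivative_intros) auto
  ultimately obtain c where c: "\<And>x. x \<in> M \<Longrightarrow> h x = c"
    using constant_if_partials_zero[OF M(1,2), of h] by blast
  have "V = affine_field M a b c"
  proof
    fix x show "V x = affine_field M a b c x"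
    proof (cases "x \<in> M")
      case True
      have "V x = (\<xi> x, \<tau> x, \<phi> x)"
        by (simp add: xi_coeff_def tau_coeff_def phi_coeff_def)
      then show ?thesis
        using True \<xi> b c[OF True] by (simp add: affine_field_apply h_def algebra_simps)
    next
      case False
      then show ?thesis using smooth
        by (simp add: smooth_vfields_def affine_field_apply del: split_paired_All)
    qed
  qed
  then show ?thesis using span_V(3) by blast
qed

end

theorem theorem3p1:
  fixes \<sigma> \<rho> :: real and g :: "real \<Rightarrow> real" and J :: "real set" and M :: "point set"
  assumes "\<sigma>\<^sup>2 > 0" and "\<rho> > 0"
    and "open J" and "connected J" and "J \<noteq> {}"
    and "g differentiable_on J" and "deriv g differentiable_on J" and "\<forall>\<alpha>\<in>J. g \<alpha> \<noteq> 0"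
    and "open M" and "connected M" and "M \<noteq> {}"
  shows "lie_algebra (lie_bracket M) (L3 M) \<and> dim (L3 M) = 3 \<and>
    L3 M \<subseteq> pde_symmetry_algebra M J \<sigma> \<rho> g \<and>
    (\<not> special_form J \<rho> g \<longrightarrow> pde_symmetry_algebra M J \<sigma> \<rho> g = L3 M) \<and>
    lie_bracket M (V1 M) (V2 M) = - V2 M \<and> - V2 M \<noteq> 0 \<and>
    lie_bracket M (V1 M) (V3 M) = 0 \<and> lie_bracket M (V2 M) (V3 M) = 0 \<and>
    lie_subalgebra (lie_bracket M) (L3 M) (L2 M) \<and> dim (L2 M) = 2 \<and>
    decomposable (lie_bracket M) (L3 M) \<and>
    semidirect_sum (lie_bracket M) (L3 M) (L2 M) (span {V3 M}) \<and>
    semidirect_sum (lie_bracket M) (L3 M) (span {V3 M}) (L2 M)"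
proof -
  interpret pde_setting \<sigma> \<rho> g J M
    using assms by unfold_locales auto
  note lie = lie_structure[OF M(1,3)]
  have L3: "L3 M \<subseteq> pde_symmetry_algebra M J \<sigma> \<rho> g"
    using affine_field_symmetry by (auto simp: span_V(3))
  have generic: "pde_symmetry_algebra M J \<sigma> \<rho> g = L3 M" if "\<not> special_form J \<rho> g"
  proof
    show "pde_symmetry_algebra M J \<sigma> \<rho> g \<subseteq> L3 M"
    proof
      fix V assume V: "V \<in> pde_symmetry_algebra M J \<sigma> \<rho> g"
      then have "V \<in> smooth_vfields M"
        by (simp add: pde_symmetry_algebra_def symmetry_algebra_def)
      then interpret generic_symmetry \<sigma> \<rho> g J M V
        using V that M(1) by unfold_locales
      show "V \<in> L3 M" by (rule symmetry_in_L3)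
    qed
  qed (rule L3)
  \<comment> \<open>Both summands are ideals, so each can also serve as the complementary subalgebra
    of the other.\<close>
  have sub: "lie_subalgebra (lie_bracket M) (L3 M) A" if "lie_ideal (lie_bracket M) (L3 M) A" for A
    using that by (auto simp: lie_ideal_def lie_subalgebra_def)
  have "decomposable (lie_bracket M) (L3 M)"
    unfolding decomposable_def using lie(6-8,10,11) by blast
  then show ?thesis
    unfolding semidirect_sum_def using lie L3 generic sub by auto
qed

end
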